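(* Suppose the universe size $U = \mathrm{poly}(n)$ is a sufficiently large polynomial in $n$. Consider a (deterministic) classical open-addressed hash table that stores $n$ keys in $N = (1+\Theta(\epsilon)) n$ slots (load factor $1-\epsilon$, with $1/n \le \epsilon \le \Theta(1)$), uses a nearly uniform probe-sequence function $h$, and, at any given moment of the workload below, has expected average probe complexity (over the currently stored keys) $O\big(2^{\sqrt{\log \epsilon^{-1}}}\big)$. Then the expected amortized switching cost per insertion or deletion is $\Omega(\log \log \epsilon^{-1})$.
   Context: The hash table has slots $[N]$, slot $N$ being a special slot: each inserted key is first placed into the special slot, and the algorithm then rearranges keys to move it to a normal slot. A probe-sequence function $h$ maps each key $x \in [U]$ to a sequence $(h_1(x), h_2(x), \ldots)$ with entries in $[N] \cup \{\mathrm{Null}\}$. A key $x$ stored in slot $s$ has probe complexity $\min\{k : h_k(x) = s\}$; a key in the special slot has probe complexity $N$. For $i \ge 1$ and $s \in [N]$ let $q(h,i,s) = n \Pr_{x \in [U]}[h_k(x) = s \text{ for some } k \le i]$ ($x$ uniform). $h$ is nearly uniform if there is an absolute constant $C$ with $q(h,i,s) \le C i^{10}$ for all $i, s$. The switching cost of an insertion or deletion is the number of keys moved between slots during it. The workload: initialize the table with $n$ uniformly random keys from $[U]$, then repeat $n^2$ times: delete a uniformly random element of the current key set $S$, then insert a uniformly random element of $[U]\setminus S$. *)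

theory Defs
  imports "HOL-Probability.Probability"
begin

text \<open>
  Keys are the naturals \<open>1, \<dots>, U\<close>, slots are \<open>1, \<dots>, N\<close>, and \<open>N\<close> is the special slot.
  A probe-sequence function \<open>h\<close> is used as \<open>h x k = h\<^sub>k(x)\<close>, where \<open>None\<close> stands for Null;
  probes are numbered from \<open>1\<close>, so the value \<open>h x 0\<close> is never looked at.
\<close>

type_synonym key = nat
type_synonym slot = nat
type_synonym probe_fun = "key \<Rightarrow> nat \<Rightarrow> slot option"

definition probe_function :: "nat \<Rightarrow> nat \<Rightarrow> probe_fun \<Rightarrow> bool" where
  "probe_function U N h \<longleftrightarrow>
     (\<forall>x\<in>{1..U}. \<forall>k\<ge>1. \<forall>s. h x k = Some s \<longrightarrow> s \<in> {1..N})"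

definition probe_complexity :: "nat \<Rightarrow> probe_fun \<Rightarrow> key \<Rightarrow> slot \<Rightarrow> nat" where
  "probe_complexity N h x s = (if s = N then N else (LEAST k. k \<ge> 1 \<and> h x k = Some s))"

definition q :: "nat \<Rightarrow> nat \<Rightarrow> probe_fun \<Rightarrow> nat \<Rightarrow> slot \<Rightarrow> real" where
  "q n U h i s =
     real n * measure_pmf.prob (pmf_of_set {1..U}) {x. \<exists>k\<in>{1..i}. h x k = Some s}"

text \<open>The constant is an explicit parameter so that it can be quantified before \<open>n\<close>.\<close>

definition nearly_uniform :: "real \<Rightarrow> nat \<Rightarrow> nat \<Rightarrow> nat \<Rightarrow> probe_fun \<Rightarrow> bool" where
  "nearly_uniform C n U N h \<longleftrightarrow>
     (\<forall>i\<ge>1. \<forall>s\<in>{1..N}. q n U h i s \<le> C * real i ^ 10)"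

datatype operation = Ins key | Del key

text \<open>Histories list the operations with the most recent one first.\<close>

type_synonym history = "operation list"

fun keys :: "history \<Rightarrow> key set" where
  "keys [] = {}"
| "keys (Ins x # w) = insert x (keys w)"
| "keys (Del x # w) = keys w - {x}"

fun legal :: "nat \<Rightarrow> nat \<Rightarrow> history \<Rightarrow> bool" where
  "legal U n [] \<longleftrightarrow> True"
| "legal U n (Ins x # w) \<longleftrightarrow> legal U n w \<and> x \<in> {1..U} - keys w \<and> card (keys w) < n"
| "legal U n (Del x # w) \<longleftrightarrow> legal U n w \<and> x \<in> keys w"

text \<open>
  A deterministic hash table is determined by the slots in which the stored keys lie after each
  history: \<open>A w x = Some s\<close> says that after \<open>w\<close> the key \<open>x\<close> lies in slot \<open>s\<close>. The arrangement may
  depend on the whole history, so the algorithm may keep arbitrary additional state. Between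
  operations the special slot is empty, and a key only lies in slots of its own probe sequence
  (otherwise its probe complexity would be undefined).
\<close>

type_synonym arrangement = "key \<Rightarrow> slot option"
type_synonym hash_table = "history \<Rightarrow> arrangement"

definition classical_table :: "nat \<Rightarrow> nat \<Rightarrow> nat \<Rightarrow> probe_fun \<Rightarrow> hash_table \<Rightarrow> bool" where
  "classical_table U n N h A \<longleftrightarrow>
     (\<forall>w. legal U n w \<longrightarrow>
        dom (A w) = keys w \<and>
        inj_on (A w) (dom (A w)) \<and>
        (\<forall>x s. A w x = Some s \<longrightarrow> s \<in> {1..<N} \<and> (\<exists>k\<ge>1. h x k = Some s)))"

definition average_probe_complexity :: "nat \<Rightarrow> probe_fun \<Rightarrow> arrangement \<Rightarrow> real" where
  "average_probe_complexity N h m =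
     (\<Sum>x\<in>dom m. real (probe_complexity N h x (the (m x)))) / real (card (dom m))"

text \<open>
  The arrangement from which the algorithm starts rearranging keys: an inserted key has been put
  into the special slot, a deleted key has been taken out.
\<close>

fun before_rearranging :: "nat \<Rightarrow> operation \<Rightarrow> arrangement \<Rightarrow> arrangement" where
  "before_rearranging N (Ins x) m = m(x \<mapsto> N)"
| "before_rearranging N (Del x) m = m(x := None)"

definition switching_cost :: "nat \<Rightarrow> hash_table \<Rightarrow> operation \<Rightarrow> history \<Rightarrow> nat" where
  "switching_cost N A p w =
     card {y \<in> keys (p # w). before_rearranging N p (A w) y \<noteq> A (p # w) y}"

text \<open>The total switching cost of the \<open>j\<close> most recent operations of a history.\<close>

fun total_switching_cost :: "nat \<Rightarrow> hash_table \<Rightarrow> nat \<Rightarrow> history \<Rightarrow> nat" where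
  "total_switching_cost N A (Suc j) (p # w) =
     switching_cost N A p w + total_switching_cost N A j w"
| "total_switching_cost N A _ _ = 0"

definition random_insert :: "nat \<Rightarrow> history \<Rightarrow> history pmf" where
  "random_insert U w = map_pmf (\<lambda>x. Ins x # w) (pmf_of_set ({1..U} - keys w))"

definition random_delete :: "history \<Rightarrow> history pmf" where
  "random_delete w = map_pmf (\<lambda>x. Del x # w) (pmf_of_set (keys w))"

text \<open>Inserting \<open>m\<close> keys, each uniform among those not yet present: \<open>m\<close> random distinct keys.\<close>

fun initialization :: "nat \<Rightarrow> nat \<Rightarrow> history pmf" where
  "initialization U 0 = return_pmf []"
| "initialization U (Suc m) = bind_pmf (initialization U m) (random_insert U)"

text \<open>
  The history after initialization with \<open>n\<close> keys and \<open>j\<close> further operations, which alternate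
  between deletions and insertions. The full workload has \<open>j = 2 * n\<^sup>2\<close>.
\<close>

fun workload :: "nat \<Rightarrow> nat \<Rightarrow> nat \<Rightarrow> history pmf" where
  "workload n U 0 = initialization U n"
| "workload n U (Suc j) =
     bind_pmf (workload n U j) (if even j then random_delete else random_insert U)"

definition expected_average_probe_complexity ::
    "nat \<Rightarrow> nat \<Rightarrow> nat \<Rightarrow> probe_fun \<Rightarrow> hash_table \<Rightarrow> nat \<Rightarrow> real" where
  "expected_average_probe_complexity n U N h A j =
     measure_pmf.expectation (workload n U j) (\<lambda>w. average_probe_complexity N h (A w))"

text \<open>Averaged over the \<open>2 * n\<^sup>2\<close> deletions and insertions that follow the initialization.\<close>

definition expected_amortized_switching_cost :: "nat \<Rightarrow> nat \<Rightarrow> nat \<Rightarrow> hash_table \<Rightarrow> real" where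
  "expected_amortized_switching_cost n U N A =
     measure_pmf.expectation (workload n U (2 * n ^ 2))
       (\<lambda>w. real (total_switching_cost N A (2 * n ^ 2) w)) / real (2 * n ^ 2)"

end

(*
  Fix a scale I between 2 powr sqrt (log 2 (1 / eps)) and a small power of 1 / eps, and compare the
  arrangements before and after an epoch of about n / I random deletions and insertions. Following
  each old slot to the key that occupies it at the end, and that key back to its old slot, links the
  random slots of the deleted keys to the random new keys by chains of displaced keys; only the few
  chains that end in a free slot are lost. A displaced key with old and new probe complexity k and l
  gets the cost const + 12 ln k + 12 ln l. Near uniformity and a first moment computation show that
  few pairs of a deleted slot and a new key can be joined by chains of total cost below
  W = ln (I / const), while the bound on the average probe complexity rules out probe complexities
  above I^2 for most keys. So each epoch produces a total cost of order W n / I at keys whose old or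
  new probe complexity is at most I^2.

  Divided by W, the cost of one displaced key summed over the scales I = exp (kappa 2^l) is a
  truncated geometric series, hence bounded. As there are of order log log (1 / eps) such scales,
  so many moves per operation are needed.
*)

theory Submission
  imports Defs
begin

section \<open>The random workload\<close>

text \<open>The table may react to every operation, so the chains it will use cannot be predicted.
  The first moment therefore runs over all lists of distinct stored keys and arbitrary normal slots,
  with weights (\<open>exp\<close> of minus the cost) that depend on \<open>h\<close> and
  \<open>\<theta>\<close> alone. It converges because a chain loses half of its expected weight per
  link: a slot receives total affinity at most \<open>2 * C * U / n\<close> from all keys, a key is
  stored with probability at most n / U, it gives its slots total affinity at most 2, and
  \<open>\<theta> = 1 / (8 * C)\<close> turns the product into 1 / 2. An epoch of i = n / I pairs of
  operations joins deleted slots to new keys with expected total weight of order i^2 / n = i / I. So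
  by Markov only a small fraction of i new keys can lie within distance ln (I / const): this fixes
  \<open>W\<close>, and the length of the epoch is chosen so that free slots and keys of high probe
  complexity are few against i as well. With s = sqrt (log 2 (1 / \<open>\<epsilon>\<close>)), the
  admissible ln I range from order s to order s^2. Doubling ln I gives about log 2 s scales, and log
  2 (log 2 (1 / \<open>\<epsilon>\<close>)) is twice that.\<close>

abbreviation E :: "'a pmf \<Rightarrow> ('a \<Rightarrow> real) \<Rightarrow> real" where
  "E p f \<equiv> measure_pmf.expectation p f"

lemma E_eq_sum: "finite (set_pmf p) \<Longrightarrow> E p f = (\<Sum>w\<in>set_pmf p. pmf p w * f w)"
  by (subst integral_measure_pmf_real[of "set_pmf p"]) (auto simp: mult.commute set_pmf_eq)

lemma E_mono:
  assumes "finite (set_pmf p)" "\<And>w. w \<in> set_pmf p \<Longrightarrow> f w \<le> g w"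
  shows "E p f \<le> E p g"
  using assms by (simp add: E_eq_sum sum_mono mult_left_mono)

lemma E_cong:
  assumes "\<And>w. w \<in> set_pmf p \<Longrightarrow> f w = g w"
  shows "E p f = E p g"
  using assms by (intro integral_cong_AE) (auto simp: AE_measure_pmf_iff)

lemma E_add: "finite (set_pmf p) \<Longrightarrow> E p (\<lambda>w. f w + g w) = E p f + E p g"
  by (simp add: E_eq_sum distrib_left sum.distrib)

lemma E_diff: "finite (set_pmf p) \<Longrightarrow> E p (\<lambda>w. f w - g w) = E p f - E p g"
  by (simp add: E_eq_sum right_diff_distrib sum_subtractf)

lemma E_sum: "finite (set_pmf p) \<Longrightarrow> E p (\<lambda>w. \<Sum>i\<in>I. f i w) = (\<Sum>i\<in>I. E p (f i))"
  by (subst (1) E_eq_sum, simp, subst sum_distrib_left, subst sum.swap) (simp add: E_eq_sum)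

lemma E_bind:
  assumes "finite (set_pmf p)" "\<And>w. w \<in> set_pmf p \<Longrightarrow> finite (set_pmf (f w))"
  shows "E (bind_pmf p f) g = E p (\<lambda>w. E (f w) g)"
  using assms by (subst pmf_expectation_bind[of "set_pmf p"]) (auto simp: E_eq_sum)

lemma E_delete:
  assumes "finite (keys w)" "keys w \<noteq> {}"
  shows "E (random_delete w) f = (\<Sum>x\<in>keys w. f (Del x # w)) / card (keys w)"
  using assms unfolding random_delete_def by (simp add: integral_pmf_of_set)

lemma E_insert:
  assumes "{1..U} - keys w \<noteq> {}"
  shows "E (random_insert U w) f = (\<Sum>x\<in>{1..U} - keys w. f (Ins x # w)) / card ({1..U} - keys w)"
  using assms unfolding random_insert_def by (simp add: integral_pmf_of_set)

text \<open>The workload resumed from a fixed history; it begins with a deletion and so takes over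
  at even times. Conditioning an epoch on its starting history \<open>w\<close> makes
  \<open>A w\<close> and the chains through \<open>keys w\<close> constants, and only the choice of
  deleted and inserted keys stays random.\<close>

fun run :: "nat \<Rightarrow> nat \<Rightarrow> history \<Rightarrow> history pmf" where
  "run U 0 w = return_pmf w"
| "run U (Suc i) w = bind_pmf (run U i w) (if even i then random_delete else random_insert U)"

lemma workload_run:
  "workload n U (2 * m + i) = bind_pmf (workload n U (2 * m)) (run U i)"
  by (induction i) (simp_all add: bind_return_pmf' bind_assoc_pmf[symmetric])

text \<open>These are two terms of the binomial expansion of the right side. With
  \<open>x = m / U\<close> and \<open>y = 1 / U\<close> the inequality closes the induction over
  insertions in \<open>contains_insert_step\<close>.\<close>

lemma power_pred_step: "real t * x ^ (t - 1) * y + x ^ t \<le> (x + y) ^ t" if "0 \<le> x" "0 \<le> (y::real)"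
proof (cases t)
  case (Suc k)
  have "x ^ Suc j + real (Suc j) * x ^ j * y \<le> (x + y) ^ Suc j" for j
  proof (induction j)
    case 0
    show ?case by simp
  next
    case (Suc j)
    have "x ^ Suc (Suc j) + real (Suc (Suc j)) * x ^ Suc j * y \<le>
        (x ^ Suc j + real (Suc j) * x ^ j * y) * (x + y)"
      using that by (simp add: algebra_simps)
    also have "\<dots> \<le> (x + y) ^ Suc j * (x + y)"
      using Suc that by (intro mult_right_mono) auto
    finally show ?case by (simp add: mult.commute)
  qed
  then show ?thesis using Suc by (simp add: add.commute)
qed simp

section \<open>Reachable states and finite supports of the workload\<close>

locale random_workload =
  fixes n U :: nat
  assumes n_pos: "1 \<le> n" and U_large: "2 * n \<le> U"
begin

definition state :: "nat \<Rightarrow> history \<Rightarrow> bool" where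
  "state m w \<longleftrightarrow> legal U n w \<and> card (keys w) = m \<and> finite (keys w) \<and> keys w \<subseteq> {1..U}"

lemma stateD:
  assumes "state m w"
  shows "legal U n w" "card (keys w) = m" "finite (keys w)" "keys w \<subseteq> {1..U}"
  using assms by (auto simp: state_def)

lemma card_absent: "state m w \<Longrightarrow> card ({1..U} - keys w) = U - m"
  by (simp add: state_def card_Diff_subset)

lemma absent_nonempty: "state m w \<Longrightarrow> m \<le> n \<Longrightarrow> {1..U} - keys w \<noteq> {}"
  using card_absent[of m w] U_large n_pos by (metis card.empty diff_is_0_eq le_trans mult_2 not_one_le_zero add_le_same_cancel1)

lemma set_insert:
  assumes "state m w" "m < n"
  shows "set_pmf (random_insert U w) = (\<lambda>x. Ins x # w) ` ({1..U} - keys w)"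
  using absent_nonempty[OF assms(1)] assms unfolding random_insert_def by simp

lemma set_delete:
  assumes "state m w" "0 < m"
  shows "set_pmf (random_delete w) = (\<lambda>x. Del x # w) ` keys w"
proof -
  have "finite (keys w)" "keys w \<noteq> {}" using assms by (auto simp: state_def)
  then show ?thesis by (simp add: random_delete_def)
qed

lemma state_insert:
  assumes "state m w" "m < n" "x \<in> {1..U} - keys w"
  shows "state (Suc m) (Ins x # w)"
  using assms by (auto simp: state_def)

lemma state_delete:
  assumes "state m w" "x \<in> keys w"
  shows "state (m - 1) (Del x # w)"
  using assms by (auto simp: state_def)

lemma support_initialization:
  "m \<le> n \<Longrightarrow> finite (set_pmf (initialization U m)) \<and> (\<forall>w\<in>set_pmf (initialization U m). state m w)"
proof (induction m)
  case 0
  show ?case by (simp add: state_def)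
next
  case (Suc m)
  then have fin: "finite (set_pmf (initialization U m))"
    and st: "\<And>w. w \<in> set_pmf (initialization U m) \<Longrightarrow> state m w" and m: "m < n"
    by auto
  have *: "set_pmf (initialization U (Suc m)) =
      (\<Union>w\<in>set_pmf (initialization U m). (\<lambda>x. Ins x # w) ` ({1..U} - keys w))"
    using set_insert[OF st m] by simp
  show ?case unfolding * using fin state_insert[OF st m] by auto
qed

definition phase :: "nat \<Rightarrow> nat" where "phase i = (if even i then n else n - 1)"

lemma support_step:
  assumes "state (phase i) w"
  shows "finite (set_pmf ((if even i then random_delete else random_insert U) w))"
    and "w' \<in> set_pmf ((if even i then random_delete else random_insert U) w) \<Longrightarrow>
      state (phase (Suc i)) w' \<and> (\<exists>p. w' = p # w)"
proof -
  show "finite (set_pmf ((if even i then random_delete else random_insert U) w))"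
    using assms n_pos by (auto simp: phase_def set_insert[of "n-1"] set_delete[of n] stateD(3))
  show "state (phase (Suc i)) w' \<and> (\<exists>p. w' = p # w)"
    if "w' \<in> set_pmf ((if even i then random_delete else random_insert U) w)"
  proof (cases "even i")
    case True
    then have "state n w" using assms by (simp add: phase_def)
    then show ?thesis
      using that True n_pos state_delete[of n w] by (auto simp: phase_def set_delete[of n])
  next
    case False
    then have "state (n - 1) w" using assms by (simp add: phase_def)
    then show ?thesis
      using that False n_pos state_insert[of "n - 1" w] by (auto simp: phase_def set_insert[of "n - 1"])
  qed
qed

lemma support_run:
  assumes "state n w"
  shows "finite (set_pmf (run U i w)) \<and>
    (\<forall>w'\<in>set_pmf (run U i w). state (phase i) w' \<and> (\<exists>us. w' = us @ w \<and> length us = i))"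
proof (induction i)
  case 0
  show ?case using assms by (simp add: phase_def)
next
  case (Suc i)
  have fin: "finite (set_pmf (run U i w))"
    and st: "\<And>v. v \<in> set_pmf (run U i w) \<Longrightarrow> state (phase i) v"
    and ap: "\<And>v. v \<in> set_pmf (run U i w) \<Longrightarrow> \<exists>us. v = us @ w \<and> length us = i"
    using Suc.IH by auto
  have "finite (set_pmf (run U (Suc i) w))"
    using fin support_step(1)[OF st] by simp
  moreover have "state (phase (Suc i)) w' \<and> (\<exists>us. w' = us @ w \<and> length us = Suc i)"
    if "w' \<in> set_pmf (run U (Suc i) w)" for w'
  proof -
    obtain v where v: "v \<in> set_pmf (run U i w)"
      "w' \<in> set_pmf ((if even i then random_delete else random_insert U) v)"
      using \<open>w' \<in> set_pmf (run U (Suc i) w)\<close> by auto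
    obtain p where p: "w' = p # v" "state (phase (Suc i)) w'"
      using support_step(2)[OF st[OF v(1)] v(2)] by blast
    obtain us where us: "v = us @ w" "length us = i" using ap[OF v(1)] by blast
    then have "w' = (p # us) @ w \<and> length (p # us) = Suc i"
      using p by simp
    then show ?thesis using p(2) by blast
  qed
  ultimately show ?case by blast
qed

lemma support_workload:
  "finite (set_pmf (workload n U j)) \<and> (\<forall>w\<in>set_pmf (workload n U j). state (phase j) w)"
proof (induction j)
  case 0
  show ?case using support_initialization[of n] by (simp add: phase_def)
next
  case (Suc j)
  have fin: "finite (set_pmf (workload n U j))"
    and st: "\<And>v. v \<in> set_pmf (workload n U j) \<Longrightarrow> state (phase j) v"
    using Suc.IH by auto
  show ?case
    unfolding workload.simps set_bind_pmf
    using fin support_step(1)[OF st] support_step(2)[OF st] by blast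
qed

lemma finite_run: "state n w \<Longrightarrow> finite (set_pmf (run U i w))"
  using support_run by blast

lemma state_run: "state n w \<Longrightarrow> w' \<in> set_pmf (run U i w) \<Longrightarrow> state (phase i) w'"
  using support_run by blast

lemma finite_workload: "finite (set_pmf (workload n U j))"
  using support_workload by blast

lemma state_workload: "w \<in> set_pmf (workload n U j) \<Longrightarrow> state (phase j) w"
  using support_workload by blast

lemma state_workload_even: "w \<in> set_pmf (workload n U (2 * m)) \<Longrightarrow> state n w"
  using state_workload[of w "2 * m"] by (simp add: phase_def)

lemma E_run_Suc:
  "state n w \<Longrightarrow> E (run U (Suc i) w) f =
     E (run U i w) (\<lambda>w. E ((if even i then random_delete else random_insert U) w) f)"
  unfolding run.simps using finite_run support_step(1)[OF state_run]
  by (intro E_bind)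

lemma E_workload_run:
  "E (workload n U (2 * m + i)) f = E (workload n U (2 * m)) (\<lambda>w. E (run U i w) f)"
  unfolding workload_run
  using finite_workload finite_run[OF state_workload_even] by (intro E_bind)

section \<open>Probability that a given set of keys is stored\<close>

lemma insert_contains:
  assumes st: "state m w" and m: "m < n"
  shows "E (random_insert U w) (\<lambda>w. of_bool (T \<subseteq> keys w)) \<le>
    of_bool (T \<subseteq> keys w) * (1 - card T / (U - m)) + (\<Sum>x\<in>T. of_bool (T - {x} \<subseteq> keys w)) / (U - m)"
proof -
  have pos: "real (U - m) > 0" using m U_large by simp
  have eq: "E (random_insert U w) (\<lambda>w. of_bool (T \<subseteq> keys w)) =
     (\<Sum>x\<in>{1..U} - keys w. of_bool (T \<subseteq> insert x (keys w))) / (U - m)"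
    using E_insert[OF absent_nonempty[OF st]] m card_absent[OF st] by simp
  show ?thesis
  proof (cases "T \<subseteq> keys w")
    case True
    then have "(\<Sum>x\<in>{1..U} - keys w. of_bool (T \<subseteq> insert x (keys w))) = (\<Sum>x\<in>{1..U} - keys w. 1::real)"
      by (intro sum.cong) auto
    also have "\<dots> = U - m" using card_absent[OF st] by simp
    finally have "E (random_insert U w) (\<lambda>w. of_bool (T \<subseteq> keys w)) = 1"
      using eq pos by simp
    moreover have "(\<Sum>x\<in>T. of_bool (T - {x} \<subseteq> keys w)) = (\<Sum>x\<in>T. 1::real)"
      using True by (intro sum.cong) auto
    ultimately show ?thesis using True by simp
  next
    case False
    show ?thesis
    proof (cases "finite T")
      case True
      \<comment> \<open>If \<open>T\<close> is not yet stored, only the insertion of an element of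
        \<open>T\<close> can complete it, and the rest of \<open>T\<close> must then be present
        already.\<close>
      have "(\<Sum>x\<in>{1..U} - keys w. of_bool (T \<subseteq> insert x (keys w))) =
         (\<Sum>x\<in>({1..U} - keys w) \<inter> T. of_bool (T \<subseteq> insert x (keys w)) :: real)"
        using False by (intro sum.mono_neutral_right) auto
      also have "\<dots> \<le> (\<Sum>x\<in>({1..U} - keys w) \<inter> T. of_bool (T - {x} \<subseteq> keys w))"
        by (intro sum_mono) auto
      also have "\<dots> \<le> (\<Sum>x\<in>T. of_bool (T - {x} \<subseteq> keys w))"
        using True by (intro sum_mono2) auto
      finally have "(\<Sum>x\<in>{1..U} - keys w. of_bool (T \<subseteq> insert x (keys w)) :: real) \<le>
        (\<Sum>x\<in>T. of_bool (T - {x} \<subseteq> keys w))" .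
      then show ?thesis using False eq pos by (simp add: divide_right_mono)
    next
      case inf: False
      then have "\<not> T \<subseteq> insert x (keys w)" for x
        using stateD(3)[OF st] finite_subset by auto
      then show ?thesis using False eq inf by simp
    qed
  qed
qed

text \<open>Averaging \<open>insert_contains\<close> with the hypothesis for \<open>T\<close> and
  for each \<open>T - {x}\<close>, the denominators \<open>U - m\<close> combine into
  \<open>U\<close>, and exactly the left side of \<open>power_pred_step\<close> remains.\<close>

lemma contains_insert_step:
  assumes fin: "finite (set_pmf p)" and st: "\<And>w. w \<in> set_pmf p \<Longrightarrow> state m w" and m: "m < n"
    and IH: "\<And>T. finite T \<Longrightarrow> card T \<le> n \<Longrightarrow> E p (\<lambda>w. of_bool (T \<subseteq> keys w)) \<le> (m / U) ^ card T"
    and T: "finite T" "card T \<le> n"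
  shows "E (bind_pmf p (random_insert U)) (\<lambda>w. of_bool (T \<subseteq> keys w)) \<le> (Suc m / U) ^ card T"
proof -
  let ?t = "card T"
  have pos: "real (U - m) > 0" "real U > 0" using m U_large by auto
  have tle: "real ?t / real (U - m) \<le> 1"
    using T m U_large pos by (simp add: field_simps)
  have "E (bind_pmf p (random_insert U)) (\<lambda>w. of_bool (T \<subseteq> keys w)) =
     E p (\<lambda>w. E (random_insert U w) (\<lambda>w. of_bool (T \<subseteq> keys w)))"
    using set_insert[OF st m] by (intro E_bind fin) simp
  also have "\<dots> \<le> E p (\<lambda>w. of_bool (T \<subseteq> keys w) * (1 - ?t / (U - m)) +
      (\<Sum>x\<in>T. of_bool (T - {x} \<subseteq> keys w)) / (U - m))"
    using fin insert_contains[OF st m] by (intro E_mono)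
  also have "\<dots> = E p (\<lambda>w. of_bool (T \<subseteq> keys w)) * (1 - ?t / (U - m)) +
      (\<Sum>x\<in>T. E p (\<lambda>w. of_bool (T - {x} \<subseteq> keys w))) / (U - m)"
    using fin by (simp add: E_add E_sum)
  also have "\<dots> \<le> (m / U) ^ ?t * (1 - ?t / (U - m)) + (\<Sum>x\<in>T. (m / U) ^ (?t - 1)) / (U - m)"
  proof (intro add_mono mult_right_mono divide_right_mono sum_mono)
    show "E p (\<lambda>w. of_bool (T - {x} \<subseteq> keys w)) \<le> (real m / real U) ^ (?t - 1)" if "x \<in> T" for x
      using IH[of "T - {x}"] T that by (simp add: card_Diff_singleton)
  qed (use IH[OF T] tle in auto)
  also have "\<dots> = ?t * (m / U) ^ (?t - 1) * (1 / U) + (m / U) ^ ?t"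
  proof (cases ?t)
    case (Suc k)
    have "real (U - m) = real U - real m" using m U_large by simp
    then show ?thesis
      using pos Suc by (simp add: divide_simps) (simp add: algebra_simps)
  qed simp
  also have "\<dots> \<le> (m / U + 1 / U) ^ ?t"
    by (intro power_pred_step) auto
  also have "\<dots> = (Suc m / U) ^ ?t" by (simp add: add_divide_distrib add.commute)
  finally show ?thesis .
qed

lemma contains_initialization:
  "m \<le> n \<Longrightarrow> finite T \<Longrightarrow> card T \<le> n \<Longrightarrow>
     E (initialization U m) (\<lambda>w. of_bool (T \<subseteq> keys w)) \<le> (m / U) ^ card T"
proof (induction m arbitrary: T)
  case 0
  then show ?case by (cases "card T") auto
next
  case (Suc m)
  then show ?case unfolding initialization.simps
    using support_initialization[of m] by (intro contains_insert_step) auto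
qed

text \<open>With t = \<open>card T\<close>, a deletion spares a stored \<open>T\<close> with
  probability exactly 1 - t / n, and Bernoulli's inequality bounds this by (1 - 1 / n)^t, which
  turns (n / U)^t into ((n - 1) / U)^t.\<close>

lemma contains_delete_step:
  assumes fin: "finite (set_pmf p)" and st: "\<And>w. w \<in> set_pmf p \<Longrightarrow> state n w"
    and IH: "\<And>T. finite T \<Longrightarrow> card T \<le> n \<Longrightarrow> E p (\<lambda>w. of_bool (T \<subseteq> keys w)) \<le> (n / U) ^ card T"
    and T: "finite T" "card T \<le> n"
  shows "E (bind_pmf p random_delete) (\<lambda>w. of_bool (T \<subseteq> keys w)) \<le> ((n - 1) / U) ^ card T"
proof -
  let ?t = "card T"
  have U: "real U > 0" using n_pos U_large by simp
  have step: "E (random_delete w) (\<lambda>w. of_bool (T \<subseteq> keys w)) = of_bool (T \<subseteq> keys w) * (1 - ?t / n)"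
    if w: "w \<in> set_pmf p" for w
  proof -
    have k: "finite (keys w)" "keys w \<noteq> {}" "card (keys w) = n" using stateD[OF st[OF w]] n_pos by auto
    have "(\<Sum>x\<in>keys w. of_bool (T \<subseteq> keys w - {x})) = (\<Sum>x\<in>keys w - T. of_bool (T \<subseteq> keys w) :: real)"
      using k by (intro sum.mono_neutral_cong_right) auto
    also have "\<dots> = of_bool (T \<subseteq> keys w) * (real n - ?t)"
      using k T by (simp add: card_Diff_subset)
    finally show ?thesis
      using E_delete[OF k(1,2)] k(3) n_pos by (simp add: field_simps)
  qed
  have "E (bind_pmf p random_delete) (\<lambda>w. of_bool (T \<subseteq> keys w)) =
     E p (\<lambda>w. E (random_delete w) (\<lambda>w. of_bool (T \<subseteq> keys w)))"
    using set_delete[OF st] stateD(3)[OF st] n_pos by (intro E_bind fin) simp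
  also have "\<dots> = E p (\<lambda>w. of_bool (T \<subseteq> keys w)) * (1 - ?t / n)"
    using step by (subst E_cong[where g = "\<lambda>w. of_bool (T \<subseteq> keys w) * (1 - ?t / n)"]) auto
  also have "\<dots> \<le> (n / U) ^ ?t * (1 - ?t / n)"
    using IH[OF T] T n_pos by (intro mult_right_mono) auto
  also have "\<dots> \<le> (n / U) ^ ?t * (1 - 1 / n) ^ ?t"
    using Bernoulli_inequality[of "- 1 / n" ?t] n_pos by (intro mult_left_mono) (auto simp: field_simps)
  also have "\<dots> = ((n / U) * (1 - 1 / n)) ^ ?t"
    by (simp only: power_mult_distrib)
  also have "(n / U) * (1 - 1 / n) = (n - 1) / U"
    using n_pos U by (simp add: field_simps)
  finally show ?thesis .
qed

text \<open>A fixed set of keys is stored with at most the probability that independent choices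
  would give. The chain count needs nothing else about the law of the stored set, so its uniformity
  never has to be established.\<close>

lemma contains_workload:
  "finite T \<Longrightarrow> card T \<le> n \<Longrightarrow>
     E (workload n U j) (\<lambda>w. of_bool (T \<subseteq> keys w)) \<le> (phase j / U) ^ card T"
proof (induction j arbitrary: T)
  case 0
  then show ?case using contains_initialization[of n T] by (simp add: phase_def)
next
  case (Suc j)
  show ?case
  proof (cases "even j")
    case True
    then show ?thesis using contains_delete_step[of "workload n U j" T] Suc
      finite_workload[of j] state_workload[of _ j] n_pos by (simp add: phase_def of_nat_diff)
  next
    case False
    then show ?thesis using contains_insert_step[of "workload n U j" "n - 1" T] Suc
      finite_workload[of j] state_workload[of _ j] n_pos by (simp add: phase_def)
  qed
qed

end

section \<open>Keys deleted and inserted during one epoch\<close>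

lemma divide_le_add_divide: "s \<le> c * g + h \<Longrightarrow> 0 < c \<Longrightarrow> s / c \<le> g + h / (c::real)"
  by (simp add: field_simps)

lemma sum_of_bool_eq_mult:
  "finite A \<Longrightarrow> (\<Sum>y\<in>A. of_bool (y = d) * h) = (if d \<in> A then h else (0::real))"
proof -
  assume "finite A"
  have "(\<Sum>y\<in>A. of_bool (y = d) * h) = (\<Sum>y\<in>A. if y = d then h else 0)"
    by (intro sum.cong) auto
  then show ?thesis using \<open>finite A\<close> by simp
qed

lemma sum_of_bool_mem: "finite A \<Longrightarrow> (\<Sum>y\<in>A. of_bool (y \<in> S)) = real (card (A \<inter> S))"
  using sum.inter_restrict[of A "\<lambda>_. 1::real" S] by (simp add: of_bool_def)

context random_workload
begin

lemma E_run_pair: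
  assumes "state n w"
  shows "E (run U (2 * Suc i) w) f =
    E (run U (2 * i) w) (\<lambda>v. E (random_delete v) (\<lambda>v'. E (random_insert U v') f))"
  using E_run_Suc[OF assms, of "Suc (2 * i)" f] E_run_Suc[OF assms, of "2 * i"] by simp

lemma state_run_even: "state n w \<Longrightarrow> v \<in> set_pmf (run U (2 * i) w) \<Longrightarrow> state n v"
  using state_run[of w v "2 * i"] by (simp add: phase_def)

lemma E_delete_state:
  "state n v \<Longrightarrow> E (random_delete v) f = (\<Sum>y\<in>keys v. f (Del y # v)) / n"
  using E_delete[of v f] n_pos stateD(2,3)[of n v] by fastforce

lemma E_insert_state:
  "state (n - 1) v \<Longrightarrow> E (random_insert U v) f = (\<Sum>y\<in>{1..U} - keys v. f (Ins y # v)) / (U - n + 1)"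
  using E_insert[OF absent_nonempty[of "n - 1" v], of f] card_absent[of "n - 1" v] n_pos U_large
  by (simp add: of_nat_diff)

lemma E_delete_le:
  assumes v: "state n v" and f: "\<And>y. y \<in> keys v \<Longrightarrow> f (Del y # v) \<le> g + of_bool (y = d) * h" and h: "0 \<le> h"
  shows "E (random_delete v) f \<le> g + h / n"
proof -
  note k = stateD[OF v]
  have "(\<Sum>y\<in>keys v. f (Del y # v)) \<le> (\<Sum>y\<in>keys v. g + of_bool (y = d) * h)"
    using f by (rule sum_mono)
  also have "\<dots> \<le> n * g + h"
    using h by (simp only: sum.distrib sum_of_bool_eq_mult[OF k(3)] sum_constant k(2)) simp
  finally show ?thesis
    using n_pos by (simp add: E_delete_state[OF v] field_simps)
qed

lemma E_insert_le:
  assumes v: "state (n - 1) v" and h: "0 \<le> h"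
    and f: "\<And>y. y \<in> {1..U} - keys v \<Longrightarrow> f (Ins y # v) \<le> g + of_bool (y = x) * h"
  shows "E (random_insert U v) f \<le> g + h / (U - n)"
proof -
  have c: "card ({1..U} - keys v) = U - n + 1" using card_absent[OF v] n_pos U_large by simp
  have "(\<Sum>y\<in>{1..U} - keys v. f (Ins y # v)) \<le> (\<Sum>y\<in>{1..U} - keys v. g + of_bool (y = x) * h)"
    using f by (rule sum_mono)
  also have "\<dots> = (U - n + 1) * g + (if x \<in> {1..U} - keys v then h else 0)"
    by (simp only: sum.distrib sum_of_bool_eq_mult finite_Diff finite_atLeastAtMost sum_constant c)
  also have "\<dots> \<le> (U - n + 1) * g + h"
    using h by simp
  finally have "E (random_insert U v) f \<le> g + h / (U - n + 1)"
    unfolding E_insert_state[OF v] by (intro divide_le_add_divide) auto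
  also have "\<dots> \<le> g + h / (U - n)"
    using h n_pos U_large by (intro add_left_mono divide_left_mono) auto
  finally show ?thesis .
qed

text \<open>The three bounds need a common induction: the joint event newly arises only when
  \<open>x\<close> is inserted with \<open>d\<close> already gone or when \<open>d\<close> is
  deleted, so its growth is assembled from the two single probabilities. In units of 1 / (n (U - n))
  this reads i^2 + i + (i + 1) = (i + 1)^2. Returning \<open>d\<close> or removing \<open>x\<close>
  only lowers the indicators.\<close>

lemma run_prob:
  assumes w: "state n w" and d: "d \<in> keys w" and x: "x \<notin> keys w"
  shows "E (run U (2 * i) w) (\<lambda>v. of_bool (d \<notin> keys v)) \<le> i / n
    \<and> E (run U (2 * i) w) (\<lambda>v. of_bool (x \<in> keys v)) \<le> i / (U - n)
    \<and> E (run U (2 * i) w) (\<lambda>v. of_bool (d \<notin> keys v \<and> x \<in> keys v)) \<le> real i ^ 2 / (n * (U - n))"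
proof (induction i)
  case 0
  show ?case using d x by simp
next
  case (Suc i)
  have n0: "real n > 0" "real (U - n) > 0" using n_pos U_large by auto
  have fd: "finite (set_pmf (random_delete v))" if "state n v" for v
    using set_delete[OF that] n_pos stateD(3)[OF that] by simp
  have sd: "state (n - 1) v'" if "state n v" "v' \<in> set_pmf (random_delete v)" for v v'
    using set_delete[OF that(1)] n_pos state_delete[OF that(1)] that(2) by auto
  have fin: "finite (set_pmf (run U (2 * i) w))" by (rule finite_run[OF w])
  let ?c = "1 / real (U - n)"
  have A: "E (random_delete v) (\<lambda>v'. E (random_insert U v') (\<lambda>v. of_bool (d \<notin> keys v)))
     \<le> of_bool (d \<notin> keys v) + 1 / n" if v: "state n v" for v
  proof -
    have "E (random_delete v) (\<lambda>v'. E (random_insert U v') (\<lambda>v. of_bool (d \<notin> keys v)))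
      \<le> E (random_delete v) (\<lambda>v'. of_bool (d \<notin> keys v'))"
    proof (intro E_mono fd v)
      fix v' assume "v' \<in> set_pmf (random_delete v)"
      then show "E (random_insert U v') (\<lambda>v. of_bool (d \<notin> keys v)) \<le> of_bool (d \<notin> keys v')"
        using E_insert_le[OF sd[OF v], of v' 0 "\<lambda>v. of_bool (d \<notin> keys v)" "of_bool (d \<notin> keys v')" 0] by auto
    qed
    also have "\<dots> \<le> of_bool (d \<notin> keys v) + 1 / n"
      by (intro E_delete_le[OF v, where d = d]) auto
    finally show ?thesis .
  qed
  have B: "E (random_delete v) (\<lambda>v'. E (random_insert U v') (\<lambda>v. of_bool (x \<in> keys v)))
     \<le> of_bool (x \<in> keys v) + 1 / (U - n)" if v: "state n v" for v
  proof -
    have "E (random_delete v) (\<lambda>v'. E (random_insert U v') (\<lambda>v. of_bool (x \<in> keys v)))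
      \<le> E (random_delete v) (\<lambda>v'. of_bool (x \<in> keys v') + 1 / (U - n))"
    proof (intro E_mono fd v)
      fix v' assume "v' \<in> set_pmf (random_delete v)"
      then show "E (random_insert U v') (\<lambda>v. of_bool (x \<in> keys v)) \<le> of_bool (x \<in> keys v') + 1 / (U - n)"
        by (intro E_insert_le[OF sd[OF v], where x = x]) auto
    qed
    also have "\<dots> \<le> of_bool (x \<in> keys v) + 1 / (U - n) + 0 / n"
      by (intro E_delete_le[OF v, where d = x]) auto
    finally show ?thesis by simp
  qed
  have D: "E (random_delete v) (\<lambda>v'. E (random_insert U v') (\<lambda>v. of_bool (d \<notin> keys v \<and> x \<in> keys v)))
     \<le> of_bool (d \<notin> keys v \<and> x \<in> keys v) + of_bool (d \<notin> keys v) * ?c + (of_bool (x \<in> keys v) + ?c) / n"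
    if v: "state n v" for v
  proof -
    have "E (random_delete v) (\<lambda>v'. E (random_insert U v') (\<lambda>v. of_bool (d \<notin> keys v \<and> x \<in> keys v)))
      \<le> E (random_delete v) (\<lambda>v'. of_bool (d \<notin> keys v' \<and> x \<in> keys v') + of_bool (d \<notin> keys v') / (U - n))"
    proof (intro E_mono fd v)
      fix v' assume "v' \<in> set_pmf (random_delete v)"
      then show "E (random_insert U v') (\<lambda>v. of_bool (d \<notin> keys v \<and> x \<in> keys v))
          \<le> of_bool (d \<notin> keys v' \<and> x \<in> keys v') + of_bool (d \<notin> keys v') / (U - n)"
        by (intro E_insert_le[OF sd[OF v], where x = x]) auto
    qed
    also have "\<dots> \<le> of_bool (d \<notin> keys v \<and> x \<in> keys v) + of_bool (d \<notin> keys v) * ?c + (of_bool (x \<in> keys v) + ?c) / n"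
      by (intro E_delete_le[OF v, where d = d]) auto
    finally show ?thesis .
  qed
  note st = state_run_even[OF w]
  have "E (run U (2 * Suc i) w) (\<lambda>v. of_bool (d \<notin> keys v)) \<le>
      E (run U (2 * i) w) (\<lambda>v. of_bool (d \<notin> keys v) + 1 / n)"
    unfolding E_run_pair[OF w] by (intro E_mono fin A st)
  also have "\<dots> = E (run U (2 * i) w) (\<lambda>v. of_bool (d \<notin> keys v)) + 1 / n"
    using fin by (simp add: E_add)
  also have "\<dots> \<le> i / n + 1 / n" using Suc.IH by simp
  finally have 1: "E (run U (2 * Suc i) w) (\<lambda>v. of_bool (d \<notin> keys v)) \<le> Suc i / n"
    by (simp add: add_divide_distrib)
  have "E (run U (2 * Suc i) w) (\<lambda>v. of_bool (x \<in> keys v)) \<le>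
      E (run U (2 * i) w) (\<lambda>v. of_bool (x \<in> keys v) + 1 / (U - n))"
    unfolding E_run_pair[OF w] by (intro E_mono fin B st)
  also have "\<dots> = E (run U (2 * i) w) (\<lambda>v. of_bool (x \<in> keys v)) + 1 / (U - n)"
    using fin by (simp add: E_add)
  also have "\<dots> \<le> i / (U - n) + 1 / (U - n)" using Suc.IH by simp
  finally have 2: "E (run U (2 * Suc i) w) (\<lambda>v. of_bool (x \<in> keys v)) \<le> Suc i / (U - n)"
    by (simp add: add_divide_distrib)
  have "E (run U (2 * Suc i) w) (\<lambda>v. of_bool (d \<notin> keys v \<and> x \<in> keys v)) \<le>
      E (run U (2 * i) w) (\<lambda>v. of_bool (d \<notin> keys v \<and> x \<in> keys v) + of_bool (d \<notin> keys v) * ?c + (of_bool (x \<in> keys v) + ?c) / n)"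
    unfolding E_run_pair[OF w] by (intro E_mono fin D st)
  also have "\<dots> = E (run U (2 * i) w) (\<lambda>v. of_bool (d \<notin> keys v \<and> x \<in> keys v))
     + E (run U (2 * i) w) (\<lambda>v. of_bool (d \<notin> keys v)) * ?c
     + (E (run U (2 * i) w) (\<lambda>v. of_bool (x \<in> keys v)) + ?c) / n"
    using fin by (simp only: E_add integral_mult_left_zero integral_divide_zero) (simp add: E_add)
  also have "\<dots> \<le> real i ^ 2 / (n * (U - n)) + i / n * ?c + (i / (U - n) + ?c) / n"
    using Suc.IH n0 by (intro add_mono mult_right_mono divide_right_mono) auto
  also have "\<dots> = real (Suc i) ^ 2 / (n * (U - n))"
  proof -
    have "x ^ 2 / (a * b) + x / a * (1 / b) + (x / b + 1 / b) / a = (x + 1) ^ 2 / (a * b)"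
      if "a > 0" "b > 0" for x a b :: real
      using that by (simp add: field_simps power2_eq_square)
    from this[OF n0, of i] show ?thesis by (simp add: add.commute)
  qed
  finally show ?case using 1 2 by blast
qed

text \<open>If r keys of \<open>S\<close> are missing, the deletion hits one of the other n - r with
  probability 1 - r / n, and the insertion restores each missing key with probability 1 / (U - n +
  1).\<close>

lemma run_deleted_step:
  assumes v: "state n v" and S: "finite S" "card S = n" "S \<subseteq> {1..U}"
  shows "E (random_delete v) (\<lambda>v'. E (random_insert U v') (\<lambda>v. card (S - keys v))) =
    (card (S - keys v) * (1 - 1 / n) + 1) * (1 - 1 / (U - n + 1))"
proof -
  have ins: "E (random_insert U v') (\<lambda>v. card (S - keys v)) = card (S - keys v') * (1 - 1 / (U - n + 1))"
    if v': "state (n - 1) v'" for v'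
  proof -
    have c: "card ({1..U} - keys v') = U - n + 1" using card_absent[OF v'] n_pos U_large by simp
    have "(\<Sum>y\<in>{1..U} - keys v'. real (card (S - keys (Ins y # v')))) =
       (\<Sum>y\<in>{1..U} - keys v'. real (card (S - keys v')) - of_bool (y \<in> S))"
    proof (intro sum.cong refl)
      fix y assume y: "y \<in> {1..U} - keys v'"
      have "S - keys (Ins y # v') = (S - keys v') - {y}" by auto
      moreover have "card (S - keys v') > 0" if "y \<in> S"
        using y S that by (auto simp: card_gt_0_iff)
      ultimately show "real (card (S - keys (Ins y # v'))) = real (card (S - keys v')) - of_bool (y \<in> S)"
        using S y by (auto simp: card_Diff_singleton_if of_nat_diff Suc_leI)
    qed
    also have "\<dots> = (U - n + 1) * real (card (S - keys v')) - card (({1..U} - keys v') \<inter> S)"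
      by (simp only: sum_subtractf sum_constant c sum_of_bool_mem finite_Diff finite_atLeastAtMost)
    also have "({1..U} - keys v') \<inter> S = S - keys v'" using S by auto
    finally show ?thesis
      using U_large by (simp add: E_insert_state[OF v'] field_simps)
  qed
  note k = stateD[OF v]
  have r: "card (S \<inter> keys v) = n - card (S - keys v)" "card (S - keys v) \<le> n"
    using S by (auto simp: card_Diff_subset_Int card_mono intro: card_mono)
  have del: "E (random_delete v) (\<lambda>v'. card (S - keys v')) = card (S - keys v) * (1 - 1 / n) + 1"
  proof -
    have "(\<Sum>y\<in>keys v. real (card (S - keys (Del y # v)))) = (\<Sum>y\<in>keys v. real (card (S - keys v)) + of_bool (y \<in> S))"
    proof (intro sum.cong refl)
      fix y assume y: "y \<in> keys v"
      have "S - keys (Del y # v) = (if y \<in> S then insert y (S - keys v) else S - keys v)" using y by auto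
      then show "real (card (S - keys (Del y # v))) = real (card (S - keys v)) + of_bool (y \<in> S)"
        using S y by auto
    qed
    also have "\<dots> = n * real (card (S - keys v)) + card (S \<inter> keys v)"
      using k by (simp add: sum.distrib sum_of_bool_mem Int_commute)
    also have "\<dots> = n * real (card (S - keys v)) + n - card (S - keys v)"
      using r by (simp add: of_nat_diff)
    finally show ?thesis using n_pos by (simp add: E_delete_state[OF v] field_simps)
  qed
  have "E (random_delete v) (\<lambda>v'. E (random_insert U v') (\<lambda>v. card (S - keys v))) =
      E (random_delete v) (\<lambda>v'. card (S - keys v') * (1 - 1 / (U - n + 1)))"
    using set_delete[OF v] state_delete[OF v] n_pos by (intro E_cong ins) auto
  then show ?thesis using del by simp
qed

text \<open>A pair of operations loses one old key, except that the deletion may hit a key inserted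
  meanwhile and the insertion may restore an old key. On average at most i old keys are missing and
  4 i is at most n, so each effect costs at most 1 / 4 and the expected growth is at least 1 / 2.
  The upper bound is carried along for this estimate.\<close>

lemma run_deleted:
  assumes w: "state n w" and i: "4 * i \<le> n"
  shows "i / 2 \<le> E (run U (2 * i) w) (\<lambda>v. card (keys w - keys v)) \<and>
    E (run U (2 * i) w) (\<lambda>v. card (keys w - keys v)) \<le> i"
  using i
proof (induction i)
  case 0
  show ?case by simp
next
  case (Suc i)
  let ?f = "\<lambda>i. E (run U (2 * i) w) (\<lambda>v. card (keys w - keys v))"
  let ?d = "1 / (real (U - n) + 1)"
  have n0: "real n > 0" "real (U - n) \<ge> real n" using n_pos U_large by auto
  have IH: "real i / 2 \<le> ?f i" "?f i \<le> i" using Suc by auto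
  have "?f (Suc i) = E (run U (2 * i) w) (\<lambda>v. (card (keys w - keys v) * (1 - 1 / n) + 1) * (1 - ?d))"
    unfolding E_run_pair[OF w] using run_deleted_step[OF state_run_even[OF w]] stateD[OF w]
    by (intro E_cong) (auto simp: add.commute)
  also have "\<dots> = (?f i * (1 - 1 / n) + 1) * (1 - ?d)"
    using finite_run[OF w] by (simp add: E_add)
  finally have eq: "?f (Suc i) = (?f i * (1 - 1 / n) + 1) * (1 - ?d)" .
  have f0: "0 \<le> ?f i" using IH by simp
  have a: "?f i / n \<le> 1 / 4" using IH Suc.prems n0 by (simp add: field_simps)
  have b: "?f i * (1 - 1 / n) + 1 \<le> ?f i + 1" "0 \<le> ?f i * (1 - 1 / n) + 1"
    using f0 n0 n_pos by (auto intro!: mult_left_le)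
  have d: "0 \<le> ?d" "?d \<le> 1" by auto
  have "?d * (?f i * (1 - 1 / n) + 1) \<le> ?d * (i + 1)"
    using b IH by (intro mult_left_mono) auto
  also have "\<dots> \<le> 1 / 4" using Suc.prems n0 by (simp add: field_simps)
  finally have c: "?d * (?f i * (1 - 1 / n) + 1) \<le> 1 / 4" .
  have "?f (Suc i) = ?f i - ?f i / n + 1 - ?d * (?f i * (1 - 1 / n) + 1)"
  proof -
    have "(r * (1 - 1 / m) + 1) * (1 - d) = r - r / m + 1 - d * (r * (1 - 1 / m) + 1)" for r m d :: real
      by (simp add: algebra_simps add_divide_distrib diff_divide_distrib)
    then show ?thesis unfolding eq .
  qed
  then have lo: "?f i + 1 / 2 \<le> ?f (Suc i)" using a c by linarith
  have "?f (Suc i) \<le> ?f i * (1 - 1 / n) + 1"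
    unfolding eq using b d by (intro mult_left_le) auto
  then have "?f (Suc i) \<le> ?f i + 1" using b by linarith
  then show ?case using lo IH by (simp add: field_simps)
qed

end

section \<open>Chains of displaced keys\<close>

definition probes :: "probe_fun \<Rightarrow> key \<Rightarrow> slot \<Rightarrow> bool" where
  "probes h y s \<longleftrightarrow> (\<exists>k\<ge>1. h y k = Some s)"

text \<open>Away from the special slot this is \<open>probe_complexity\<close>. For a slot that is
  never probed the \<open>LEAST\<close> is unspecified, hence the test in
  \<open>affinity\<close>.\<close>

definition label :: "probe_fun \<Rightarrow> key \<Rightarrow> slot \<Rightarrow> nat" where
  "label h y s = (LEAST k. k \<ge> 1 \<and> h y k = Some s)"

text \<open>
  The exponent 12 beats the growth \<open>i\<^sup>1\<^sup>0\<close> allowed by near uniformity by a summable factor.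
\<close>

definition affinity :: "probe_fun \<Rightarrow> key \<Rightarrow> slot \<Rightarrow> real" where
  "affinity h y s = (if probes h y s then 1 / real (label h y s) ^ 12 else 0)"

lemma label:
  assumes "probes h y s"
  shows "1 \<le> label h y s" "h y (label h y s) = Some s"
  using LeastI_ex[of "\<lambda>k. k \<ge> 1 \<and> h y k = Some s"] assms
  unfolding probes_def label_def by auto

lemma affinity_nonneg: "0 \<le> affinity h y s"
  by (simp add: affinity_def)

lemma affinity_pos: "probes h y s \<Longrightarrow> 0 < affinity h y s"
  using label(1)[of h y s] by (simp add: affinity_def)

lemma affinity_le_1: "affinity h y s \<le> 1"
  using label(1)[of h y s] by (auto simp: affinity_def)

lemma ln_affinity: "probes h y s \<Longrightarrow> - ln (affinity h y s) = 12 * ln (label h y s)"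
  using label(1)[of h y s] by (simp add: affinity_def ln_div ln_realpow)

text \<open>
  A chain starts in a slot \<open>a\<close> and is a list of pairs \<open>(y, s)\<close>: the key \<open>y\<close> could fill the slot
  reached so far, leaving the slot \<open>s\<close>. The cost of a chain is minus the logarithm of its weight.
\<close>

fun path_weight :: "probe_fun \<Rightarrow> real \<Rightarrow> slot \<Rightarrow> (key \<times> slot) list \<Rightarrow> real" where
  "path_weight h \<theta> a [] = 1"
| "path_weight h \<theta> a ((y, s) # ps) = \<theta> * affinity h y a * affinity h y s * path_weight h \<theta> s ps"

fun path_end :: "slot \<Rightarrow> (key \<times> slot) list \<Rightarrow> slot" where
  "path_end a [] = a"
| "path_end a ((y, s) # ps) = path_end s ps"

text \<open>Distinct keys make a chain of length i an event about i different stored keys, as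
  \<open>contains_workload\<close> requires. The slots are arbitrary and need not be those where the
  keys lie, so the count does not depend on the arrangement.\<close>

definition paths :: "key set \<Rightarrow> slot set \<Rightarrow> (key \<times> slot) list set" where
  "paths S M = {ps. distinct (map fst ps) \<and> set ps \<subseteq> S \<times> M}"

lemma path_weight_append:
  "path_weight h \<theta> a (ps @ qs) = path_weight h \<theta> a ps * path_weight h \<theta> (path_end a ps) qs"
  by (induction ps arbitrary: a) auto

lemma path_end_append: "path_end a (ps @ qs) = path_end (path_end a ps) qs"
  by (induction ps arbitrary: a) auto

lemma path_weight_nonneg: "0 \<le> \<theta> \<Longrightarrow> 0 \<le> path_weight h \<theta> a ps"
  by (induction ps arbitrary: a) (auto simp: affinity_nonneg)

lemma path_weight_le_1: "0 \<le> \<theta> \<Longrightarrow> \<theta> \<le> 1 \<Longrightarrow> path_weight h \<theta> a ps \<le> 1"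
proof (induction ps arbitrary: a)
  case (Cons p ps)
  obtain y s where p: "p = (y, s)" by fastforce
  have "\<theta> * affinity h y a \<le> 1"
    using Cons.prems mult_mono[of \<theta> 1 "affinity h y a" 1] affinity_le_1 affinity_nonneg by simp
  then have "\<theta> * affinity h y a * affinity h y s \<le> 1"
    using Cons.prems mult_mono[of "\<theta> * affinity h y a" 1 "affinity h y s" 1] affinity_le_1 affinity_nonneg by simp
  then have "\<theta> * affinity h y a * affinity h y s * path_weight h \<theta> s ps \<le> 1 * 1"
    using Cons path_weight_nonneg by (intro mult_mono) auto
  then show ?case using p by simp
qed simp

lemma length_path:
  assumes "finite S" "ps \<in> paths S M"
  shows "length ps \<le> card S"
proof -
  have "length ps = card (set (map fst ps))"
    using assms distinct_card[of "map fst ps"] by (simp add: paths_def)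
  also have "\<dots> \<le> card S"
    using assms by (intro card_mono) (auto simp: paths_def)
  finally show ?thesis .
qed

lemma finite_paths:
  assumes "finite S" "finite M"
  shows "finite (paths S M)"
  using length_path[OF assms(1)] assms
  by (intro finite_subset[OF _ finite_lists_length_le[of "S \<times> M" "card S"]]) (auto simp: paths_def)

text \<open>A deterministic comparison of two moments: index 0 is the start of an epoch and index 1
  its end. \<open>M\<close> stands for the normal slots, \<open>- ln \<theta>\<close> is the fixed
  cost of a link, and \<open>W\<close> is the cutoff for costs.\<close>

locale rearrangement =
  fixes h :: probe_fun and \<theta> W :: real and M :: "slot set"
    and S0 S1 :: "key set" and A0 A1 :: "key \<Rightarrow> slot"
  assumes theta: "0 < \<theta>" "\<theta> \<le> 1" and W: "0 \<le> W"
    and fin: "finite S0" "finite S1"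
    and inj: "inj_on A0 S0" "inj_on A1 S1"
    and slots: "A0 ` S0 \<subseteq> M" "A1 ` S1 \<subseteq> M"
    and probes: "\<And>y. y \<in> S0 \<Longrightarrow> probes h y (A0 y)" "\<And>y. y \<in> S1 \<Longrightarrow> probes h y (A1 y)"
begin

definition costs :: "slot \<Rightarrow> real set" where
  "costs s = {- ln (path_weight h \<theta> (A0 d) ps) | d ps.
     d \<in> S0 - S1 \<and> ps \<in> paths S0 M \<and> 0 < path_weight h \<theta> (A0 d) ps \<and> path_end (A0 d) ps = s}"

text \<open>The distance of a slot from the slots of the deleted keys, truncated at \<open>W\<close>.\<close>

definition dist_deleted :: "slot \<Rightarrow> real" where
  "dist_deleted s = Inf (insert W (costs s))"

text \<open>The exceptional new keys, reached too cheaply from a deleted slot. The closing step has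
  one affinity and no factor \<open>\<theta>\<close>, because a new key has left no old slot
  behind.\<close>

definition light :: "key set" where
  "light = {x \<in> S1 - S0. \<exists>d\<in>S0 - S1. \<exists>ps\<in>paths S0 M. path_end (A0 d) ps = A1 x \<and>
     exp (- W) \<le> path_weight h \<theta> (A0 d) ps * affinity h x (A1 x)}"

lemma costs_nonneg: "e \<in> insert W (costs s) \<Longrightarrow> 0 \<le> e"
  using W path_weight_le_1[of \<theta> h] theta by (fastforce simp: costs_def)

lemma bdd_below_costs: "bdd_below (insert W (costs s))"
  using costs_nonneg by (meson bdd_belowI)

lemma dist_deleted_le: "e \<in> insert W (costs s) \<Longrightarrow> dist_deleted s \<le> e"
  unfolding dist_deleted_def by (rule cInf_lower[OF _ bdd_below_costs])

lemma dist_deleted_nonneg: "0 \<le> dist_deleted s"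
  unfolding dist_deleted_def using costs_nonneg by (intro cInf_greatest) auto

lemma dist_deleted_le_W: "dist_deleted s \<le> W"
  by (rule dist_deleted_le) simp

lemma dist_deleted_start:
  assumes "d \<in> S0 - S1"
  shows "dist_deleted (A0 d) = 0"
proof -
  have "- ln (path_weight h \<theta> (A0 d) []) \<in> costs (A0 d)"
    unfolding costs_def using assms
    by (intro CollectI exI[of _ d] exI[of _ "[]"]) (auto simp: paths_def)
  then show ?thesis
    using dist_deleted_le[of 0 "A0 d"] dist_deleted_nonneg[of "A0 d"] by simp
qed

definition swap_cost :: "key \<Rightarrow> real" where
  "swap_cost y = - ln (\<theta> * affinity h y (A1 y) * affinity h y (A0 y))"

text \<open>At the end \<open>y\<close> fills \<open>A1 y\<close> and may have left
  \<open>A0 y\<close>, so a chain that reaches \<open>A1 y\<close> can be continued by the link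
  \<open>(y, A0 y)\<close>. For the cutoff value \<open>W\<close> it suffices that the cost is
  nonnegative.\<close>

lemma dist_deleted_step:
  assumes y: "y \<in> S0" "y \<in> S1"
  shows "dist_deleted (A0 y) \<le> dist_deleted (A1 y) + swap_cost y"
proof -
  have pr: "0 < affinity h y (A0 y)" "0 < affinity h y (A1 y)"
    using probes y affinity_pos by auto
  have pos: "0 < \<theta> * affinity h y (A1 y) * affinity h y (A0 y)"
    using pr theta by simp
  have le1: "\<theta> * affinity h y (A1 y) * affinity h y (A0 y) \<le> 1"
    using path_weight_le_1[of \<theta> h "A1 y" "[(y, A0 y)]"] theta by simp
  have c0: "0 \<le> swap_cost y" using pos le1 by (simp add: swap_cost_def)
  have "dist_deleted (A0 y) - swap_cost y \<le> dist_deleted (A1 y)"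
    unfolding dist_deleted_def[of "A1 y"]
  proof (rule cInf_greatest)
    fix e assume "e \<in> insert W (costs (A1 y))"
    then consider "e = W" | "e \<in> costs (A1 y)" by blast
    then show "dist_deleted (A0 y) - swap_cost y \<le> e"
    proof cases
      case 1
      then show ?thesis using dist_deleted_le_W[of "A0 y"] c0 by linarith
    next
      case 2
      then obtain d ps where d: "d \<in> S0 - S1" and ps: "ps \<in> paths S0 M"
        and w: "0 < path_weight h \<theta> (A0 d) ps" and en: "path_end (A0 d) ps = A1 y"
        and e: "e = - ln (path_weight h \<theta> (A0 d) ps)"
        unfolding costs_def by blast
      have "\<exists>qs\<in>paths S0 M. path_end (A0 d) qs = A0 y \<and>
         path_weight h \<theta> (A0 d) ps * (\<theta> * affinity h y (A1 y) * affinity h y (A0 y)) \<le> path_weight h \<theta> (A0 d) qs"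
      proof (cases "y \<in> fst ` set ps")
        case False
        then have "ps @ [(y, A0 y)] \<in> paths S0 M"
          using ps y slots by (auto simp: paths_def)
        then show ?thesis
          using en by (intro bexI[of _ "ps @ [(y, A0 y)]"]) (auto simp: path_weight_append path_end_append)
      next
        \<comment> \<open>The chain already uses \<open>y\<close>, so appending the link would
          destroy distinctness. The chain is cut at that occurrence instead and \<open>y\<close> is
          sent to \<open>A0 y\<close>; all factors dropped on the way are at most 1.\<close>
        case True
        then obtain s where "(y, s) \<in> set ps" by auto
        then obtain pre post where split: "ps = pre @ (y, s) # post"
          by (meson split_list)
        let ?a = "path_end (A0 d) pre" and ?w = "path_weight h \<theta> (A0 d) pre"
        have nn: "0 \<le> ?w" "0 \<le> path_weight h \<theta> s post" "path_weight h \<theta> s post \<le> 1"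
          using path_weight_nonneg path_weight_le_1 theta by auto
        have q: "pre @ [(y, A0 y)] \<in> paths S0 M"
          using ps y slots split by (auto simp: paths_def)
        have "path_weight h \<theta> (A0 d) ps * (\<theta> * affinity h y (A1 y) * affinity h y (A0 y)) =
          ?w * (\<theta> * affinity h y ?a * affinity h y (A0 y)) *
            (affinity h y s * path_weight h \<theta> s post * (\<theta> * affinity h y (A1 y)))"
          by (simp add: split path_weight_append)
        also have "\<dots> \<le> ?w * (\<theta> * affinity h y ?a * affinity h y (A0 y)) * 1"
        proof (rule mult_left_mono)
          have "affinity h y s * path_weight h \<theta> s post * (\<theta> * affinity h y (A1 y)) \<le> (1 * 1) * (1 * 1)"
            using nn theta affinity_nonneg affinity_le_1 by (intro mult_mono) auto
          then show "affinity h y s * path_weight h \<theta> s post * (\<theta> * affinity h y (A1 y)) \<le> 1" by simp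
        qed (use nn theta affinity_nonneg in auto)
        also have "\<dots> = path_weight h \<theta> (A0 d) (pre @ [(y, A0 y)])"
          by (simp add: path_weight_append)
        finally show ?thesis using q
          by (intro bexI[of _ "pre @ [(y, A0 y)]"]) (auto simp: path_end_append)
      qed
      then obtain qs where qs: "qs \<in> paths S0 M" "path_end (A0 d) qs = A0 y"
        and le: "path_weight h \<theta> (A0 d) ps * (\<theta> * affinity h y (A1 y) * affinity h y (A0 y)) \<le> path_weight h \<theta> (A0 d) qs"
        by blast
      have lpos: "0 < path_weight h \<theta> (A0 d) ps * (\<theta> * affinity h y (A1 y) * affinity h y (A0 y))"
        using w pos by simp
      then have qpos: "0 < path_weight h \<theta> (A0 d) qs" using le by linarith
      have "- ln (path_weight h \<theta> (A0 d) qs) \<in> costs (A0 y)"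
        unfolding costs_def using d qs qpos by blast
      then have "dist_deleted (A0 y) \<le> - ln (path_weight h \<theta> (A0 d) qs)"
        by (intro dist_deleted_le) simp
      also have "\<dots> \<le> - ln (path_weight h \<theta> (A0 d) ps * (\<theta> * affinity h y (A1 y) * affinity h y (A0 y)))"
        using le lpos qpos by (simp only: neg_le_iff_le ln_le_cancel_iff)
      also have "\<dots> = e + swap_cost y"
        using w pos unfolding e swap_cost_def by (subst ln_mult) auto
      finally show ?thesis by simp
    qed
  qed simp
  then show ?thesis by simp
qed

lemma dist_deleted_new:
  assumes x: "x \<in> S1 - S0" and nl: "x \<notin> light"
  shows "W \<le> dist_deleted (A1 x) - ln (affinity h x (A1 x))"
proof (rule ccontr)
  assume "\<not> ?thesis"
  then have lt: "dist_deleted (A1 x) < W + ln (affinity h x (A1 x))" by simp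
  have a: "0 < affinity h x (A1 x)" "affinity h x (A1 x) \<le> 1"
    using probes x affinity_pos affinity_le_1 by auto
  obtain e where e: "e \<in> insert W (costs (A1 x))" "e < W + ln (affinity h x (A1 x))"
    using lt cInf_lessD[of "insert W (costs (A1 x))"] unfolding dist_deleted_def by blast
  \<comment> \<open>Hence \<open>e < W\<close>, so \<open>e\<close> is not the cutoff but the cost
    of an actual chain; closed by \<open>x\<close>, that chain makes \<open>x\<close> light.\<close>
  have "ln (affinity h x (A1 x)) \<le> 0" using a by simp
  then have "e \<in> costs (A1 x)" using e by auto
  then obtain d ps where d: "d \<in> S0 - S1" "ps \<in> paths S0 M" "path_end (A0 d) ps = A1 x"
    and w: "0 < path_weight h \<theta> (A0 d) ps" and e': "e = - ln (path_weight h \<theta> (A0 d) ps)"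
    unfolding costs_def by blast
  have "- W < ln (path_weight h \<theta> (A0 d) ps * affinity h x (A1 x))"
    using e(2) e' w a by (simp add: ln_mult)
  then have "exp (- W) < path_weight h \<theta> (A0 d) ps * affinity h x (A1 x)"
    using w a by (metis exp_less_mono exp_ln mult_pos_pos)
  then have "x \<in> light" unfolding light_def using x d by (auto intro!: bexI[of _ d] bexI[of _ ps])
  then show False using nl by simp
qed

text \<open>
  Instead of following the chains one by one, we sum \<open>dist_deleted\<close> over all occupied slots before
  and after: it vanishes on the slots of deleted keys, is almost \<open>W\<close> on those of new keys, and a
  displaced key changes it by at most its cost.
\<close>

theorem rearrangement_bound:
  "W * (real (card (S1 - S0)) - card light - card (S1 \<inter> B) - card (A1 ` S1 - A0 ` S0)) \<le>
     (\<Sum>y\<in>S0 \<inter> S1. if A0 y = A1 y \<or> y \<in> B then 0 else swap_cost y)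
   + (\<Sum>x\<in>S1 - S0. if x \<in> B then 0 else - ln (affinity h x (A1 x)))"
proof -
  let ?u = dist_deleted
  have finI: "finite (A0 ` S0)" "finite (A1 ` S1)" using fin by auto
  have "(\<Sum>y\<in>S1. ?u (A1 y)) = (\<Sum>s\<in>A1 ` S1. ?u s)"
    using inj by (simp add: sum.reindex)
  \<comment> \<open>Slots that were free at the start break the comparison, since chains may end
    there. Each is given the largest possible potential \<open>W\<close>.\<close>
  also have "\<dots> = (\<Sum>s\<in>A1 ` S1 \<inter> A0 ` S0. ?u s) + (\<Sum>s\<in>A1 ` S1 - A0 ` S0. ?u s)"
    using finI by (simp add: sum.Int_Diff)
  also have "\<dots> \<le> (\<Sum>s\<in>A0 ` S0. ?u s) + (\<Sum>s\<in>A1 ` S1 - A0 ` S0. W)"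
    using finI dist_deleted_nonneg dist_deleted_le_W by (intro add_mono sum_mono2 sum_mono) auto
  also have "(\<Sum>s\<in>A0 ` S0. ?u s) = (\<Sum>y\<in>S0. ?u (A0 y))"
    using inj by (simp add: sum.reindex)
  also have "\<dots> = (\<Sum>y\<in>S0 \<inter> S1. ?u (A0 y)) + (\<Sum>y\<in>S0 - S1. ?u (A0 y))"
    using fin by (simp add: sum.Int_Diff)
  also have "(\<Sum>y\<in>S0 - S1. ?u (A0 y)) = 0"
    using dist_deleted_start by simp
  also have "(\<Sum>y\<in>S1. ?u (A1 y)) = (\<Sum>y\<in>S0 \<inter> S1. ?u (A1 y)) + (\<Sum>x\<in>S1 - S0. ?u (A1 x))"
    using fin by (subst sum.Int_Diff[of S1 _ S0]) (auto simp: Int_commute)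
  finally have flow: "(\<Sum>y\<in>S0 \<inter> S1. ?u (A1 y)) + (\<Sum>x\<in>S1 - S0. ?u (A1 x)) \<le>
      (\<Sum>y\<in>S0 \<inter> S1. ?u (A0 y)) + W * card (A1 ` S1 - A0 ` S0)" by (simp add: mult.commute)
  \<comment> \<open>A key in \<open>B\<close> pays no cost of its own: its change of potential is at
    most \<open>W\<close> and goes into the term for \<open>S1 \<inter> B\<close>.\<close>
  have "(\<Sum>y\<in>S0 \<inter> S1. ?u (A0 y)) \<le> (\<Sum>y\<in>S0 \<inter> S1. ?u (A1 y) +
      ((if A0 y = A1 y \<or> y \<in> B then 0 else swap_cost y) + W * of_bool (y \<in> B)))"
  proof (rule sum_mono)
    fix y assume "y \<in> S0 \<inter> S1"
    then show "?u (A0 y) \<le> ?u (A1 y) + ((if A0 y = A1 y \<or> y \<in> B then 0 else swap_cost y) + W * of_bool (y \<in> B))"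
      using dist_deleted_step[of y] dist_deleted_le_W[of "A0 y"] dist_deleted_nonneg[of "A1 y"] W by auto
  qed
  moreover have "(\<Sum>x\<in>S1 - S0. W) \<le> (\<Sum>x\<in>S1 - S0. ?u (A1 x) +
      ((if x \<in> B then 0 else - ln (affinity h x (A1 x))) + (W * of_bool (x \<in> light) + W * of_bool (x \<in> B))))"
  proof (rule sum_mono)
    fix x assume x: "x \<in> S1 - S0"
    then have "0 < affinity h x (A1 x)" using probes(2) affinity_pos by auto
    then have "ln (affinity h x (A1 x)) \<le> 0" using affinity_le_1 by simp
    then show "W \<le> ?u (A1 x) + ((if x \<in> B then 0 else - ln (affinity h x (A1 x))) + (W * of_bool (x \<in> light) + W * of_bool (x \<in> B)))"
      using dist_deleted_new[OF x] dist_deleted_nonneg[of "A1 x"] W by auto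
  qed
  moreover have "(\<Sum>x\<in>S1 - S0. W * of_bool (x \<in> light)) = W * card light"
  proof -
    have "light \<subseteq> S1 - S0" by (auto simp: light_def)
    then have "(S1 - S0) \<inter> light = light" by auto
    then show ?thesis using fin sum.inter_restrict[of "S1 - S0" "\<lambda>_. 1::real" light]
      by (simp add: sum_distrib_left[symmetric] of_bool_def)
  qed
  moreover have "(\<Sum>y\<in>S0 \<inter> S1. W * of_bool (y \<in> B)) + (\<Sum>x\<in>S1 - S0. W * of_bool (x \<in> B)) = W * card (S1 \<inter> B)"
  proof -
    have "(\<Sum>y\<in>S0 \<inter> S1. W * of_bool (y \<in> B)) + (\<Sum>x\<in>S1 - S0. W * of_bool (x \<in> B)) = (\<Sum>y\<in>S1. W * of_bool (y \<in> B))"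
      using fin by (subst sum.Int_Diff[of S1 _ S0]) (auto simp: Int_commute)
    then show ?thesis using fin sum.inter_restrict[of S1 "\<lambda>_. 1::real" B]
      by (simp add: sum_distrib_left[symmetric] of_bool_def)
  qed
  ultimately show ?thesis
    using flow by (simp add: sum.distrib algebra_simps)
qed

end

section \<open>Counting cheap chains\<close>

lemma sum_inverse_squares_le: "(\<Sum>k=1..K. 1 / real k ^ 2) \<le> 2"
proof -
  \<comment> \<open>The telescoping estimate must start with one term, since
    \<open>1 / 0 = 0\<close> would spoil the first induction step.\<close>
  have "(\<Sum>k=1..Suc K. 1 / real k ^ 2) \<le> 2 - 1 / Suc K" for K
  proof (induction K)
    case (Suc K)
    have "1 / real (Suc (Suc K)) ^ 2 \<le> 1 / Suc K - 1 / Suc (Suc K)"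
    proof -
      have "1 / (a + 1) ^ 2 \<le> 1 / a - 1 / (a + 1)" if "0 < a" for a :: real
      proof -
        have "1 / a - 1 / (a + 1) = 1 / (a * (a + 1))" using that by (simp add: field_simps)
        then show ?thesis
          using that by (simp add: power2_eq_square frac_le mult_right_mono)
      qed
      from this[of "real (Suc K)"] show ?thesis by (simp add: add.commute)
    qed
    then show ?case using Suc by simp
  qed simp
  note * = this
  show ?thesis
  proof (cases K)
    case (Suc k)
    have "2 - 1 / real (Suc k) \<le> 2" by simp
    then show ?thesis using *[of k] unfolding Suc by linarith
  qed simp
qed

lemma sum_inverse_squares_subset:
  assumes "finite A" "0 \<notin> A"
  shows "(\<Sum>k\<in>A. 1 / real k ^ 2) \<le> 2"
proof -
  have "A \<subseteq> {1..Max (insert 0 A)}" using assms by (auto simp: Suc_le_eq intro: Max_ge gr0I)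
  then have "(\<Sum>k\<in>A. 1 / real k ^ 2) \<le> (\<Sum>k=1..Max (insert 0 A). 1 / real k ^ 2)"
    by (intro sum_mono2) auto
  then show ?thesis using sum_inverse_squares_le order_trans by blast
qed

text \<open>The k-th probe of a key is at most one slot, so distinct probed slots have distinct
  labels and the sum is dominated by that of the inverse squares.\<close>

lemma sum_affinity_slots:
  assumes "finite M"
  shows "(\<Sum>s\<in>M. affinity h y s) \<le> 2"
proof -
  let ?M = "{s \<in> M. probes h y s}"
  have inj: "inj_on (label h y) ?M"
    using label(2) by (intro inj_onI) (metis (mono_tags, lifting) mem_Collect_eq option.inject)
  have "(\<Sum>s\<in>M. affinity h y s) = (\<Sum>s\<in>?M. 1 / real (label h y s) ^ 12)"
    using assms by (intro sum.mono_neutral_cong_right) (auto simp: affinity_def)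
  also have "\<dots> \<le> (\<Sum>s\<in>?M. 1 / real (label h y s) ^ 2)"
  proof (rule sum_mono)
    fix s assume "s \<in> ?M"
    then have "1 \<le> real (label h y s)" using label(1)[of h y s] by simp
    then show "1 / real (label h y s) ^ 12 \<le> 1 / real (label h y s) ^ 2"
      by (intro divide_left_mono power_increasing mult_pos_pos zero_less_power) auto
  qed
  also have "\<dots> = (\<Sum>k\<in>label h y ` ?M. 1 / real k ^ 2)"
    using inj by (simp add: sum.reindex)
  also have "\<dots> \<le> 2"
    using assms label(1)[of h y] by (intro sum_inverse_squares_subset) force+
  finally show ?thesis .
qed

text \<open>Grouping by label: near uniformity admits at most \<open>C * k ^ 10 * U / n\<close> keys
  of label k, each of affinity k^-12, which leaves \<open>C * U / n\<close> times a sum of inverse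
  squares.\<close>

lemma sum_affinity_keys:
  assumes nu: "nearly_uniform C n U N h" and s: "s \<in> {1..N}" and n: "1 \<le> n" and U: "1 \<le> U" and C: "0 \<le> C"
  shows "(\<Sum>y\<in>{1..U}. affinity h y s) \<le> 2 * C * U / n"
proof -
  let ?Y = "{y \<in> {1..U}. probes h y s}"
  have count: "real (card {y \<in> ?Y. label h y s = k}) \<le> C * real k ^ 10 * U / n" if k: "1 \<le> k" for k
  proof -
    have le: "card {y \<in> ?Y. label h y s = k} \<le> card ({1..U} \<inter> {x. \<exists>j\<in>{1..k}. h x j = Some s})"
      using k label(2)[of h _ s] by (intro card_mono) (auto intro!: bexI[of _ k])
    have "q n U h k s \<le> C * real k ^ 10" using nu s k by (simp add: nearly_uniform_def)
    moreover have "q n U h k s = real n * (card ({1..U} \<inter> {x. \<exists>j\<in>{1..k}. h x j = Some s}) / U)"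
      using U unfolding q_def by (simp add: measure_pmf_of_set)
    moreover have "c \<le> X * u / m" if "m * (c / u) \<le> X" "0 < m" "0 < u" for c X u m :: real
      using that by (simp add: field_simps)
    ultimately have "real (card ({1..U} \<inter> {x. \<exists>j\<in>{1..k}. h x j = Some s})) \<le> C * real k ^ 10 * U / n"
      using n U by auto
    then show ?thesis using le by linarith
  qed
  have "(\<Sum>y\<in>{1..U}. affinity h y s) = (\<Sum>y\<in>?Y. 1 / real (label h y s) ^ 12)"
    by (intro sum.mono_neutral_cong_right) (auto simp: affinity_def)
  also have "\<dots> = (\<Sum>k\<in>(\<lambda>y. label h y s) ` ?Y. \<Sum>y\<in>{y \<in> ?Y. label h y s = k}. 1 / real (label h y s) ^ 12)"
    by (intro sum.image_gen) auto
  also have "\<dots> = (\<Sum>k\<in>(\<lambda>y. label h y s) ` ?Y. card {y \<in> ?Y. label h y s = k} * (1 / real k ^ 12))"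
    by (intro sum.cong refl) simp
  also have "\<dots> \<le> (\<Sum>k\<in>(\<lambda>y. label h y s) ` ?Y. C * U / n * (1 / real k ^ 2))"
  proof (rule sum_mono)
    fix k assume "k \<in> (\<lambda>y. label h y s) ` ?Y"
    then have k: "1 \<le> k" using label(1)[of h] by auto
    have "card {y \<in> ?Y. label h y s = k} * (1 / real k ^ 12) \<le> C * real k ^ 10 * U / n * (1 / real k ^ 12)"
      using count[OF k] by (intro mult_right_mono) auto
    also have "\<dots> = C * U / n * (real k ^ 10 / real k ^ 12)" by simp
    also have "real k ^ 10 / real k ^ 12 = 1 / real k ^ 2"
    proof -
      have *: "real k ^ 12 = real k ^ 10 * real k ^ 2" by (simp flip: power_add)
      show ?thesis unfolding * using k by (intro nonzero_divide_mult_cancel_left) simp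
    qed
    finally show "card {y \<in> ?Y. label h y s = k} * (1 / real k ^ 12) \<le> C * U / n * (1 / real k ^ 2)" .
  qed
  also have "\<dots> = C * U / n * (\<Sum>k\<in>(\<lambda>y. label h y s) ` ?Y. 1 / real k ^ 2)"
    by (simp add: sum_distrib_left)
  also have "\<dots> \<le> C * U / n * 2"
    using C label(1)[of h _ s] by (intro mult_left_mono sum_inverse_squares_subset) force+
  finally show ?thesis by (simp add: mult_ac)
qed

definition lists_of :: "'a set \<Rightarrow> nat \<Rightarrow> 'a list set" where
  "lists_of A i = {xs. set xs \<subseteq> A \<and> length xs = i}"

lemma lists_of_0 [simp]: "lists_of A 0 = {[]}"
  by (auto simp: lists_of_def)

lemma finite_lists_of: "finite A \<Longrightarrow> finite (lists_of A i)"
  unfolding lists_of_def by (rule finite_lists_length_eq)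

lemma sum_lists_of_Suc:
  "(\<Sum>xs\<in>lists_of A (Suc i). f xs) = (\<Sum>a\<in>A. \<Sum>xs\<in>lists_of A i. f (a # xs))"
proof -
  have "lists_of A (Suc i) = (\<lambda>(a, xs). a # xs) ` (A \<times> lists_of A i)"
    by (auto simp: lists_of_def image_iff length_Suc_conv)
  then have "(\<Sum>xs\<in>lists_of A (Suc i). f xs) = (\<Sum>(a, xs)\<in>A \<times> lists_of A i. f (a # xs))"
    by (simp add: sum.reindex inj_on_def split_def)
  then show ?thesis by (simp add: sum.cartesian_product)
qed

text \<open>Without the distinctness condition the sum can be peeled link by link: \<open>D\<close>
  for the key that fills \<open>a\<close>, 2 for the slot it leaves and \<open>\<theta>\<close> for
  the link, uniformly in the continuation. The last \<open>D\<close> belongs to the key that closes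
  the chain.\<close>

lemma sum_path_weights:
  assumes M: "finite M" and \<theta>: "0 \<le> \<theta>" and D: "0 \<le> D" "\<And>s. s \<in> M \<Longrightarrow> (\<Sum>y\<in>{1..U}. affinity h y s) \<le> D"
    and a: "a \<in> M"
  shows "(\<Sum>ps\<in>lists_of ({1..U} \<times> M) i. path_weight h \<theta> a ps * (\<Sum>x\<in>{1..U}. affinity h x (path_end a ps)))
    \<le> (2 * \<theta> * D) ^ i * D"
  using a
proof (induction i arbitrary: a)
  case 0
  then show ?case using D by simp
next
  case (Suc i)
  let ?R = "\<lambda>a. \<Sum>ps\<in>lists_of ({1..U} \<times> M) i. path_weight h \<theta> a ps * (\<Sum>x\<in>{1..U}. affinity h x (path_end a ps))"
  have "(\<Sum>ps\<in>lists_of ({1..U} \<times> M) (Suc i). path_weight h \<theta> a ps * (\<Sum>x\<in>{1..U}. affinity h x (path_end a ps)))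
     = (\<Sum>(y, s)\<in>{1..U} \<times> M. \<theta> * affinity h y a * affinity h y s * ?R s)"
    unfolding sum_lists_of_Suc by (intro sum.cong refl) (auto simp: sum_distrib_left mult.assoc)
  also have "\<dots> = (\<Sum>y\<in>{1..U}. \<Sum>s\<in>M. \<theta> * affinity h y a * affinity h y s * ?R s)"
    by (simp add: sum.cartesian_product)
  also have "\<dots> \<le> (\<Sum>y\<in>{1..U}. \<Sum>s\<in>M. \<theta> * affinity h y a * affinity h y s * ((2 * \<theta> * D) ^ i * D))"
    using Suc.IH \<theta> affinity_nonneg by (intro sum_mono mult_left_mono) auto
  also have "\<dots> = (\<Sum>y\<in>{1..U}. affinity h y a * (\<Sum>s\<in>M. affinity h y s)) * (\<theta> * ((2 * \<theta> * D) ^ i * D))"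
    by (simp add: sum_distrib_left sum_distrib_right mult_ac)
  also have "\<dots> \<le> (\<Sum>y\<in>{1..U}. affinity h y a * 2) * (\<theta> * ((2 * \<theta> * D) ^ i * D))"
    using \<theta> D(1) affinity_nonneg sum_affinity_slots[OF M] by (intro mult_right_mono sum_mono mult_left_mono) auto
  also have "\<dots> = (\<Sum>y\<in>{1..U}. affinity h y a) * (2 * (\<theta> * ((2 * \<theta> * D) ^ i * D)))"
    by (simp add: sum_distrib_right[symmetric])
  also have "\<dots> \<le> D * (2 * (\<theta> * ((2 * \<theta> * D) ^ i * D)))"
    using D Suc.prems \<theta> by (intro mult_right_mono) auto
  finally show ?case by (simp add: mult_ac)
qed

section \<open>First moment of the chains under the random workload\<close>

context random_workload
begin

text \<open>A chain of length i is available with probability at most (n / U)^i. Distinctness is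
  used for this estimate and for the maximal length n, and is dropped afterwards so that the
  remaining sum factorizes.\<close>

lemma E_sum_paths:
  assumes M: "finite M" and f: "\<And>ps. 0 \<le> f ps"
  shows "E (workload n U (2 * m)) (\<lambda>w. \<Sum>ps\<in>paths (keys w) M. f ps) \<le>
    (\<Sum>i\<le>n. (n / U) ^ i * (\<Sum>ps\<in>lists_of ({1..U} \<times> M) i. f ps))"
proof -
  let ?p = "workload n U (2 * m)"
  let ?L = "\<lambda>i. lists_of ({1..U} \<times> M) i"
  have finL: "finite (?L i)" for i using M by (intro finite_lists_of) auto
  have "E ?p (\<lambda>w. \<Sum>ps\<in>paths (keys w) M. f ps) \<le>
    E ?p (\<lambda>w. \<Sum>i\<le>n. \<Sum>ps\<in>?L i. of_bool (distinct (map fst ps)) * f ps * of_bool (set (map fst ps) \<subseteq> keys w))"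
  proof (intro E_mono finite_workload)
    fix w assume "w \<in> set_pmf ?p"
    note st = stateD[OF state_workload_even[OF this]]
    have sub: "paths (keys w) M \<subseteq> (\<Union>i\<le>n. ?L i)"
    proof
      fix ps assume ps: "ps \<in> paths (keys w) M"
      then have "set ps \<subseteq> {1..U} \<times> M" using st(4) unfolding paths_def by blast
      then show "ps \<in> (\<Union>i\<le>n. ?L i)"
        using length_path[OF st(3) ps] st(2) by (auto simp: lists_of_def)
    qed
    have "(\<Sum>ps\<in>paths (keys w) M. f ps) =
      (\<Sum>ps\<in>paths (keys w) M. of_bool (distinct (map fst ps)) * f ps * of_bool (set (map fst ps) \<subseteq> keys w))"
      by (intro sum.cong refl) (force simp: paths_def)
    also have "\<dots> \<le> (\<Sum>ps\<in>(\<Union>i\<le>n. ?L i). of_bool (distinct (map fst ps)) * f ps * of_bool (set (map fst ps) \<subseteq> keys w))"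
      using sub f finL by (intro sum_mono2) auto
    also have "\<dots> = (\<Sum>i\<le>n. \<Sum>ps\<in>?L i. of_bool (distinct (map fst ps)) * f ps * of_bool (set (map fst ps) \<subseteq> keys w))"
      using finL by (intro sum.UNION_disjoint) (auto simp: lists_of_def)
    finally show "(\<Sum>ps\<in>paths (keys w) M. f ps) \<le> \<dots>" .
  qed
  also have "\<dots> = (\<Sum>i\<le>n. \<Sum>ps\<in>?L i. of_bool (distinct (map fst ps)) * f ps * E ?p (\<lambda>w. of_bool (set (map fst ps) \<subseteq> keys w)))"
    by (simp only: E_sum finite_workload integral_mult_right_zero)
  also have "\<dots> \<le> (\<Sum>i\<le>n. \<Sum>ps\<in>?L i. f ps * (n / U) ^ i)"
  proof (intro sum_mono)
    fix i ps assume i: "i \<in> {..n}" and ps: "ps \<in> ?L i"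
    show "of_bool (distinct (map fst ps)) * f ps * E ?p (\<lambda>w. of_bool (set (map fst ps) \<subseteq> keys w)) \<le> f ps * (n / U) ^ i"
    proof (cases "distinct (map fst ps)")
      case True
      then have "card (set (map fst ps)) = i" using ps by (simp add: distinct_card lists_of_def del: set_map)
      then have "E ?p (\<lambda>w. of_bool (set (map fst ps) \<subseteq> keys w)) \<le> (n / U) ^ i"
        using contains_workload[of "set (map fst ps)" "2 * m"] i by (simp add: phase_def del: set_map)
      then show ?thesis using True f by (simp add: mult_left_mono del: set_map)
    qed (use f in auto)
  qed
  also have "\<dots> = (\<Sum>i\<le>n. (n / U) ^ i * (\<Sum>ps\<in>?L i. f ps))"
    by (simp add: sum_distrib_left mult.commute)
  finally show ?thesis .
qed

lemma E_path_weights: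
  assumes M: "finite M" and \<theta>: "0 \<le> \<theta>" and D: "0 \<le> D" "\<And>s. s \<in> M \<Longrightarrow> (\<Sum>y\<in>{1..U}. affinity h y s) \<le> D"
    and a: "a \<in> M" and small: "n / U * (2 * \<theta> * D) \<le> 1 / 2"
  shows "E (workload n U (2 * m)) (\<lambda>w. \<Sum>ps\<in>paths (keys w) M.
      path_weight h \<theta> a ps * (\<Sum>x\<in>{1..U}. affinity h x (path_end a ps))) \<le> 2 * D"
proof -
  have "E (workload n U (2 * m)) (\<lambda>w. \<Sum>ps\<in>paths (keys w) M.
      path_weight h \<theta> a ps * (\<Sum>x\<in>{1..U}. affinity h x (path_end a ps))) \<le>
    (\<Sum>i\<le>n. (n / U) ^ i * (\<Sum>ps\<in>lists_of ({1..U} \<times> M) i.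
      path_weight h \<theta> a ps * (\<Sum>x\<in>{1..U}. affinity h x (path_end a ps))))"
    using M \<theta> path_weight_nonneg affinity_nonneg
    by (intro E_sum_paths) (auto intro!: mult_nonneg_nonneg sum_nonneg)
  also have "\<dots> \<le> (\<Sum>i\<le>n. (n / U) ^ i * ((2 * \<theta> * D) ^ i * D))"
    using sum_path_weights[OF M \<theta> D a] by (intro sum_mono mult_left_mono) auto
  also have "\<dots> = (\<Sum>i\<le>n. (n / U * (2 * \<theta> * D)) ^ i * D)"
    by (simp only: power_mult_distrib mult.assoc)
  also have "\<dots> \<le> (\<Sum>i\<le>n. (1 / 2) ^ i * D)"
    using small \<theta> D by (intro sum_mono mult_right_mono power_mono) auto
  also have "\<dots> = (\<Sum>i\<le>n. (1 / 2) ^ i) * D"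
    by (simp add: sum_distrib_right)
  also have "(\<Sum>i\<le>n. (1 / 2 :: real) ^ i) \<le> 2"
    by (simp add: sum_gp0)
  finally show ?thesis using D by (simp add: mult_right_mono)
qed

text \<open>Given \<open>w\<close>, the chains are fixed, and a pair of old key \<open>d\<close> and
  absent key \<open>x\<close> is replaced with probability at most i^2 / (n (U - n)), whatever the
  table does. So the two sources of randomness separate.\<close>

lemma E_light:
  assumes M: "finite M" and \<theta>: "0 \<le> \<theta>" and D: "0 \<le> D" "\<And>s. s \<in> M \<Longrightarrow> (\<Sum>y\<in>{1..U}. affinity h y s) \<le> D"
    and small: "n / U * (2 * \<theta> * D) \<le> 1 / 2"
    and a: "\<And>w. state n w \<Longrightarrow> inj_on (a w) (keys w) \<and> a w ` keys w \<subseteq> M"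
  shows "E (workload n U (2 * m)) (\<lambda>w. E (run U (2 * i) w) (\<lambda>v.
      \<Sum>x\<in>keys v - keys w. \<Sum>d\<in>keys w - keys v. \<Sum>ps\<in>paths (keys w) M.
        path_weight h \<theta> (a w d) ps * affinity h x (path_end (a w d) ps)))
     \<le> real i ^ 2 / (n * (U - n)) * card M * (2 * D)"
proof -
  let ?T = "\<lambda>w s x. \<Sum>ps\<in>paths (keys w) M. path_weight h \<theta> s ps * affinity h x (path_end s ps)"
  let ?c = "real i ^ 2 / (n * (U - n))"
  let ?G = "\<lambda>w s. \<Sum>ps\<in>paths (keys w) M. path_weight h \<theta> s ps * (\<Sum>x\<in>{1..U}. affinity h x (path_end s ps))"
  have T0: "0 \<le> ?T w s x" for w s x
    using \<theta> path_weight_nonneg affinity_nonneg by (auto intro!: mult_nonneg_nonneg sum_nonneg)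
  have G: "?G w s = (\<Sum>x\<in>{1..U}. ?T w s x)" for w s
    by (subst sum.swap) (simp add: sum_distrib_left)
  have inner: "E (run U (2 * i) w) (\<lambda>v. \<Sum>x\<in>keys v - keys w. \<Sum>d\<in>keys w - keys v. ?T w (a w d) x)
      \<le> ?c * (\<Sum>s\<in>M. ?G w s)" if w: "state n w" for w
  proof -
    note st = stateD[OF w]
    have "E (run U (2 * i) w) (\<lambda>v. \<Sum>x\<in>keys v - keys w. \<Sum>d\<in>keys w - keys v. ?T w (a w d) x) =
      E (run U (2 * i) w) (\<lambda>v. \<Sum>x\<in>{1..U} - keys w. \<Sum>d\<in>keys w. ?T w (a w d) x * of_bool (d \<notin> keys v \<and> x \<in> keys v))"
    proof (intro E_cong)
      fix v assume "v \<in> set_pmf (run U (2 * i) w)"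
      note sv = stateD[OF state_run_even[OF w this]]
      have "(\<Sum>x\<in>keys v - keys w. \<Sum>d\<in>keys w - keys v. ?T w (a w d) x) =
          (\<Sum>x\<in>keys v - keys w. \<Sum>d\<in>keys w. ?T w (a w d) x * of_bool (d \<notin> keys v \<and> x \<in> keys v))"
        using st by (intro sum.cong refl sum.mono_neutral_cong_left) auto
      also have "\<dots> = (\<Sum>x\<in>{1..U} - keys w. \<Sum>d\<in>keys w. ?T w (a w d) x * of_bool (d \<notin> keys v \<and> x \<in> keys v))"
        using sv by (intro sum.mono_neutral_left ballI sum.neutral) auto
      finally show "(\<Sum>x\<in>keys v - keys w. \<Sum>d\<in>keys w - keys v. ?T w (a w d) x) = \<dots>" .
    qed
    also have "\<dots> = (\<Sum>x\<in>{1..U} - keys w. \<Sum>d\<in>keys w. ?T w (a w d) x *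
        E (run U (2 * i) w) (\<lambda>v. of_bool (d \<notin> keys v \<and> x \<in> keys v)))"
      by (simp only: E_sum finite_run[OF w] integral_mult_right_zero)
    also have "\<dots> \<le> (\<Sum>x\<in>{1..U} - keys w. \<Sum>d\<in>keys w. ?T w (a w d) x * ?c)"
      using run_prob[OF w] T0 by (intro sum_mono mult_left_mono) auto
    also have "\<dots> = (\<Sum>x\<in>{1..U} - keys w. \<Sum>s\<in>a w ` keys w. ?T w s x * ?c)"
      using a[OF w] by (simp add: sum.reindex)
    also have "\<dots> \<le> (\<Sum>x\<in>{1..U}. \<Sum>s\<in>a w ` keys w. ?T w s x * ?c)"
      using T0 by (intro sum_mono2) (auto intro!: sum_nonneg mult_nonneg_nonneg)
    \<comment> \<open>Which slots are occupied depends on the history. Summing over all of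
      \<open>M\<close> removes this dependence, so that \<open>E_path_weights\<close> applies to
      each fixed start slot.\<close>
    also have "\<dots> \<le> (\<Sum>x\<in>{1..U}. \<Sum>s\<in>M. ?T w s x * ?c)"
      using T0 a[OF w] M by (intro sum_mono sum_mono2) (auto intro!: mult_nonneg_nonneg)
    also have "\<dots> = ?c * (\<Sum>s\<in>M. ?G w s)"
      unfolding G by (subst sum.swap) (simp only: sum_distrib_right mult.commute[of ?c])
    finally show ?thesis .
  qed
  have "E (workload n U (2 * m)) (\<lambda>w. E (run U (2 * i) w) (\<lambda>v.
      \<Sum>x\<in>keys v - keys w. \<Sum>d\<in>keys w - keys v. ?T w (a w d) x)) \<le>
     E (workload n U (2 * m)) (\<lambda>w. ?c * (\<Sum>s\<in>M. ?G w s))"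
    using inner state_workload_even by (intro E_mono finite_workload) auto
  also have "\<dots> = ?c * (\<Sum>s\<in>M. E (workload n U (2 * m)) (\<lambda>w. ?G w s))"
    by (simp only: E_sum finite_workload integral_mult_right_zero)
  also have "\<dots> \<le> ?c * (\<Sum>s\<in>M. 2 * D)"
    using E_path_weights[OF M \<theta> D _ small] by (intro mult_left_mono sum_mono) auto
  finally show ?thesis by (simp add: mult_ac)
qed

end

section \<open>One epoch\<close>

text \<open>The cost of one end of a displacement. \<open>c\<close> is charged at both ends,
  although \<open>swap_cost\<close> contains it once, so that a displacement splits into
  contributions of its ends. The cutoff \<open>Y\<close> keeps the sum over all scales
  bounded.\<close>

definition charge :: "probe_fun \<Rightarrow> real \<Rightarrow> real \<Rightarrow> key \<Rightarrow> slot option \<Rightarrow> real" where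
  "charge h c Y y b = (case b of None \<Rightarrow> 0
     | Some s \<Rightarrow> if probes h y s \<and> real (label h y s) \<le> Y then c + 12 * ln (label h y s) else 0)"

lemma charge_nonneg: "0 \<le> c \<Longrightarrow> 0 \<le> charge h c Y y b"
  using label(1)[of h y] by (auto simp: charge_def split: option.split)

text \<open>
  Being a sum of discrete metrics with weights at the end points, this satisfies the triangle
  inequality, so the displacement over an epoch is paid by the single operations.
\<close>

definition displacement :: "probe_fun \<Rightarrow> nat \<Rightarrow> real \<Rightarrow> real \<Rightarrow> arrangement \<Rightarrow> arrangement \<Rightarrow> real" where
  "displacement h U c Y a b =
     (\<Sum>y\<in>{1..U}. if a y = b y then 0 else charge h c Y y (a y) + charge h c Y y (b y))"

lemma displacement_nonneg: "0 \<le> c \<Longrightarrow> 0 \<le> displacement h U c Y a b"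
  unfolding displacement_def using charge_nonneg by (intro sum_nonneg) auto

lemma displacement_triangle:
  assumes "0 \<le> c"
  shows "displacement h U c Y a b \<le> displacement h U c Y a d + displacement h U c Y d b"
proof -
  have "charge h c Y y (a y) \<ge> 0" "charge h c Y y (b y) \<ge> 0" "charge h c Y y (d y) \<ge> 0" for y
    using charge_nonneg[OF assms] by auto
  then show ?thesis
    unfolding displacement_def sum.distrib[symmetric] by (intro sum_mono) auto
qed

fun accumulated :: "(operation \<Rightarrow> history \<Rightarrow> real) \<Rightarrow> nat \<Rightarrow> history \<Rightarrow> real" where
  "accumulated f (Suc j) (p # w) = f p w + accumulated f j w"
| "accumulated f _ _ = 0"

lemma accumulated_0 [simp]: "accumulated f 0 w = 0"
  by (cases w) auto

lemma accumulated_append: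
  "accumulated f (length us + j) (us @ w) = accumulated f (length us) (us @ w) + accumulated f j w"
  by (induction us) auto

lemma accumulated_nonneg: "(\<And>p w. 0 \<le> f p w) \<Longrightarrow> 0 \<le> accumulated f j w"
  by (induction f j w rule: accumulated.induct) auto

lemma displacement_le_accumulated:
  assumes "0 \<le> c"
  shows "displacement h U c Y (A w) (A (us @ w)) \<le>
    accumulated (\<lambda>p w. displacement h U c Y (A w) (A (p # w))) (length us) (us @ w)"
proof (induction us)
  case Nil
  show ?case by (simp add: displacement_def)
next
  case (Cons p us)
  show ?case
    using displacement_triangle[OF assms, of h U Y "A w" "A ((p # us) @ w)" "A (us @ w)"] Cons by simp
qed

section \<open>Displacement during one epoch and during the whole workload\<close>

locale random_table = random_workload +
  fixes N :: nat and h :: probe_fun and A :: hash_table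
  assumes table: "classical_table U n N h A"
begin

definition slot_of :: "history \<Rightarrow> key \<Rightarrow> slot" where
  "slot_of w y = the (A w y)"

lemma slot_of:
  assumes "state m w"
  shows "dom (A w) = keys w" "inj_on (slot_of w) (keys w)" "slot_of w ` keys w \<subseteq> {1..<N}"
    and "\<And>y. y \<in> keys w \<Longrightarrow> A w y = Some (slot_of w y) \<and> probes h y (slot_of w y)"
proof -
  have t: "dom (A w) = keys w" "inj_on (A w) (dom (A w))"
    "\<And>x s. A w x = Some s \<Longrightarrow> s \<in> {1..<N} \<and> (\<exists>k\<ge>1. h x k = Some s)"
    using table stateD(1)[OF assms] unfolding classical_table_def by blast+
  show "dom (A w) = keys w" by (rule t)
  have some: "A w y = Some (slot_of w y)" if "y \<in> keys w" for y
    using that t(1) domIff[of y "A w"] by (auto simp: slot_of_def)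
  show "inj_on (slot_of w) (keys w)"
    using t(2) some unfolding t(1) inj_on_def by metis
  show "slot_of w ` keys w \<subseteq> {1..<N}"
    using some t(3) by blast
  show "A w y = Some (slot_of w y) \<and> probes h y (slot_of w y)" if "y \<in> keys w" for y
    using some[OF that] t(3) by (auto simp: probes_def)
qed

text \<open>Markov's inequality. Stored keys never lie in the special slot, so their probe
  complexities are their labels.\<close>

lemma card_high_labels:
  assumes w: "state n w" and Y: "0 < Y"
  shows "card {y \<in> keys w. Y < real (label h y (slot_of w y))} \<le> n * average_probe_complexity N h (A w) / Y"
proof -
  note k = stateD[OF w] and s = slot_of[OF w]
  let ?B = "{y \<in> keys w. Y < real (label h y (slot_of w y))}"
  have "average_probe_complexity N h (A w) = (\<Sum>y\<in>keys w. real (label h y (slot_of w y))) / n"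
    unfolding average_probe_complexity_def s(1) k(2)
  proof (intro arg_cong2[where f = "(/)"] sum.cong refl)
    fix y assume "y \<in> keys w"
    then have "slot_of w y \<noteq> N" using s(3) by auto
    then show "real (probe_complexity N h y (the (A w y))) = label h y (slot_of w y)"
      by (simp add: probe_complexity_def label_def slot_of_def)
  qed
  then have eq: "n * average_probe_complexity N h (A w) = (\<Sum>y\<in>keys w. real (label h y (slot_of w y)))"
    using n_pos by simp
  have "card ?B * Y = (\<Sum>y\<in>?B. Y)" by simp
  also have "\<dots> \<le> (\<Sum>y\<in>?B. real (label h y (slot_of w y)))" by (intro sum_mono) auto
  also have "\<dots> \<le> (\<Sum>y\<in>keys w. real (label h y (slot_of w y)))"
    using k by (intro sum_mono2) auto
  finally show ?thesis using Y eq by (simp add: field_simps)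
qed

text \<open>The total weight of closed chains, an upper bound for
  \<open>exp (- W) * card light\<close> that no longer mentions the final arrangement.\<close>

definition light_mass :: "real \<Rightarrow> history \<Rightarrow> history \<Rightarrow> real" where
  "light_mass \<theta> w v = (\<Sum>x\<in>keys v - keys w. \<Sum>d\<in>keys w - keys v. \<Sum>ps\<in>paths (keys w) {1..<N}.
      path_weight h \<theta> (slot_of w d) ps * affinity h x (path_end (slot_of w d) ps))"

text \<open>This is \<open>rearrangement_bound\<close> with \<open>B\<close> the keys whose label
  exceeds \<open>Y\<close> before or after. The subtracted terms account for light keys, for
  \<open>B\<close> and for newly occupied slots; all are linear in the random quantities, so
  expectations can be taken directly.\<close>

lemma displacement_bound:
  assumes w: "state n w" and v: "state n v" and \<theta>: "0 < \<theta>" "\<theta> \<le> 1" and W: "0 \<le> W" and Y: "0 < Y"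
  shows "W * (real (card (keys w - keys v)) - exp W * light_mass \<theta> w v
      - n * (average_probe_complexity N h (A w) + average_probe_complexity N h (A v)) / Y
      - (real N - 1 - n)) \<le> displacement h U (- ln \<theta>) Y (A w) (A v)"
proof -
  note kw = stateD[OF w] and kv = stateD[OF v] and sw = slot_of[OF w] and sv = slot_of[OF v]
  interpret rearrangement h \<theta> W "{1..<N}" "keys w" "keys v" "slot_of w" "slot_of v"
    using assms kw kv sw sv by unfold_locales auto
  let ?Bw = "{y \<in> keys w. Y < real (label h y (slot_of w y))}" and ?Bv = "{y \<in> keys v. Y < real (label h y (slot_of v y))}"
  let ?B = "?Bw \<union> ?Bv"
  have c0: "0 \<le> - ln \<theta>" using \<theta> by simp
  have new: "card (keys v - keys w) = card (keys w - keys v)"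
    using kw kv card_Diff_subset_Int[of "keys v" "keys w"] card_Diff_subset_Int[of "keys w" "keys v"]
    by (simp add: Int_commute)
  have big: "real (card (keys v \<inter> ?B)) \<le> n * (average_probe_complexity N h (A w) + average_probe_complexity N h (A v)) / Y"
  proof -
    have "card (keys v \<inter> ?B) \<le> card ?B" using kw kv by (intro card_mono) auto
    also have "\<dots> \<le> card ?Bw + card ?Bv" by (rule card_Un_le)
    finally have "real (card (keys v \<inter> ?B)) \<le> real (card ?Bw) + card ?Bv" by linarith
    then show ?thesis
      using card_high_labels[OF w Y] card_high_labels[OF v Y] by (simp add: distrib_left add_divide_distrib)
  qed
  have cardw: "card (slot_of w ` keys w) = n" using sw kw by (simp add: card_image)
  \<comment> \<open>The \<open>- 1\<close> is the special slot, which is empty between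
    operations.\<close>
  have holes: "real (card (slot_of v ` keys v - slot_of w ` keys w)) \<le> real N - 1 - n"
  proof -
    have "n \<le> card {1..<N}" using cardw sw(3) card_mono[of "{1..<N}" "slot_of w ` keys w"] by simp
    moreover have "card (slot_of v ` keys v - slot_of w ` keys w) \<le> card ({1..<N} - slot_of w ` keys w)"
      using sv by (intro card_mono) auto
    moreover have "card ({1..<N} - slot_of w ` keys w) = card {1..<N} - n"
      using cardw sw kw by (subst card_Diff_subset) auto
    ultimately show ?thesis using n_pos by simp
  qed
  \<comment> \<open>Every light key has a chain of weight at least \<open>exp (- W)\<close>, so it
    adds at least that much to the light mass.\<close>
  have lig: "real (card light) \<le> exp W * light_mass \<theta> w v"
  proof -
    let ?f = "\<lambda>x d ps. path_weight h \<theta> (slot_of w d) ps * affinity h x (path_end (slot_of w d) ps)"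
    have f0: "0 \<le> ?f x d ps" for x d ps using \<theta> by (simp add: path_weight_nonneg affinity_nonneg)
    have sub: "light \<subseteq> keys v - keys w" unfolding light_def by auto
    have "real (card light) = (\<Sum>x\<in>light. 1)" by simp
    also have "\<dots> \<le> (\<Sum>x\<in>light. exp W * (\<Sum>d\<in>keys w - keys v. \<Sum>ps\<in>paths (keys w) {1..<N}. ?f x d ps))"
    proof (rule sum_mono)
      fix x assume "x \<in> light"
      then obtain d ps where d: "d \<in> keys w - keys v" "ps \<in> paths (keys w) {1..<N}"
        and e: "exp (- W) \<le> ?f x d ps" unfolding light_def by force
      have "?f x d ps \<le> (\<Sum>ps\<in>paths (keys w) {1..<N}. ?f x d ps)"
        using d f0 kw finite_paths by (intro member_le_sum) auto
      also have "\<dots> \<le> (\<Sum>d\<in>keys w - keys v. \<Sum>ps\<in>paths (keys w) {1..<N}. ?f x d ps)"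
        using d f0 kw by (intro member_le_sum) (auto intro: sum_nonneg)
      finally have "exp (- W) \<le> \<dots>" using e by linarith
      then have "exp W * exp (- W) \<le> exp W * (\<Sum>d\<in>keys w - keys v. \<Sum>ps\<in>paths (keys w) {1..<N}. ?f x d ps)"
        by (intro mult_left_mono) auto
      then show "1 \<le> exp W * (\<Sum>d\<in>keys w - keys v. \<Sum>ps\<in>paths (keys w) {1..<N}. ?f x d ps)"
        by (simp flip: exp_add)
    qed
    also have "\<dots> \<le> (\<Sum>x\<in>keys v - keys w. exp W * (\<Sum>d\<in>keys w - keys v. \<Sum>ps\<in>paths (keys w) {1..<N}. ?f x d ps))"
      using sub kv \<theta>(1)
      by (intro sum_mono2) (auto intro!: sum_nonneg mult_nonneg_nonneg simp: path_weight_nonneg affinity_nonneg)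
    also have "\<dots> = exp W * light_mass \<theta> w v"
      by (simp add: light_mass_def sum_distrib_left)
    finally show ?thesis .
  qed
  have "W * (real (card (keys w - keys v)) - exp W * light_mass \<theta> w v
      - n * (average_probe_complexity N h (A w) + average_probe_complexity N h (A v)) / Y
      - (real N - 1 - n)) \<le>
     W * (real (card (keys v - keys w)) - card light - card (keys v \<inter> ?B) - card (slot_of v ` keys v - slot_of w ` keys w))"
    using big holes lig new W by (intro mult_left_mono) auto
  also have "\<dots> \<le> (\<Sum>y\<in>keys w \<inter> keys v. if slot_of w y = slot_of v y \<or> y \<in> ?B then 0 else swap_cost y)
   + (\<Sum>x\<in>keys v - keys w. if x \<in> ?B then 0 else - ln (affinity h x (slot_of v x)))"
    by (rule rearrangement_bound)
  also have "\<dots> \<le> (\<Sum>y\<in>keys w \<inter> keys v. if A w y = A v y then 0 else charge h (- ln \<theta>) Y y (A w y) + charge h (- ln \<theta>) Y y (A v y))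
   + (\<Sum>y\<in>keys v - keys w. if A w y = A v y then 0 else charge h (- ln \<theta>) Y y (A w y) + charge h (- ln \<theta>) Y y (A v y))"
  proof (intro add_mono sum_mono)
    fix y assume y: "y \<in> keys w \<inter> keys v"
    have s: "A w y = Some (slot_of w y)" "A v y = Some (slot_of v y)"
      and p: "probes h y (slot_of w y)" "probes h y (slot_of v y)" using sw(4) sv(4) y by auto
    have "swap_cost y = - ln \<theta> + 12 * ln (label h y (slot_of v y)) + 12 * ln (label h y (slot_of w y))"
      using \<theta> affinity_pos[OF p(1)] affinity_pos[OF p(2)] ln_affinity[OF p(1)] ln_affinity[OF p(2)]
      by (simp add: swap_cost_def ln_mult)
    then show "(if slot_of w y = slot_of v y \<or> y \<in> ?B then 0 else swap_cost y) \<le>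
        (if A w y = A v y then 0 else charge h (- ln \<theta>) Y y (A w y) + charge h (- ln \<theta>) Y y (A v y))"
      using s p y c0 charge_nonneg[OF c0, of h Y y "A w y"] charge_nonneg[OF c0, of h Y y "A v y"]
      by (auto simp: charge_def)
  next
    fix x assume x: "x \<in> keys v - keys w"
    have s: "A v x = Some (slot_of v x)" and p: "probes h x (slot_of v x)" using sv(4) x by auto
    moreover have "A w x = None" using x sw(1) by blast
    ultimately show "(if x \<in> ?B then 0 else - ln (affinity h x (slot_of v x))) \<le>
        (if A w x = A v x then 0 else charge h (- ln \<theta>) Y x (A w x) + charge h (- ln \<theta>) Y x (A v x))"
      using x c0 charge_nonneg[OF c0, of h Y x "A v x"] ln_affinity[OF p]
      by (auto simp: charge_def)
  qed
  also have "\<dots> = (\<Sum>y\<in>keys v. if A w y = A v y then 0 else charge h (- ln \<theta>) Y y (A w y) + charge h (- ln \<theta>) Y y (A v y))"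
    using kv by (subst sum.Int_Diff[of "keys v" _ "keys w"]) (auto simp: Int_commute)
  also have "\<dots> \<le> displacement h U (- ln \<theta>) Y (A w) (A v)"
    unfolding displacement_def using kv charge_nonneg[OF c0] by (intro sum_mono2) auto
  finally show ?thesis .
qed

lemma E_displacement:
  fixes \<theta> W Y D P :: real
  assumes \<theta>: "0 < \<theta>" "\<theta> \<le> 1" and W: "0 \<le> W" and Y: "0 < Y"
    and D: "0 \<le> D" "\<And>s. s \<in> {1..<N} \<Longrightarrow> (\<Sum>y\<in>{1..U}. affinity h y s) \<le> D"
    and small: "n / U * (2 * \<theta> * D) \<le> 1 / 2" and i: "4 * i \<le> n"
    and P: "\<And>j. j \<le> 2 * (m + i) \<Longrightarrow> expected_average_probe_complexity n U N h A j \<le> P"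
  shows "W * (i / 2 - exp W * (real i ^ 2 / (n * (U - n)) * N * (2 * D)) - 2 * n * P / Y - (real N - 1 - n))
    \<le> E (workload n U (2 * m)) (\<lambda>w. E (run U (2 * i) w) (\<lambda>v. displacement h U (- ln \<theta>) Y (A w) (A v)))"
    (is "W * ?rhs \<le> E ?p (\<lambda>w. E (?r w) (\<lambda>v. ?disp w v))")
proof -
  let ?avg = "\<lambda>w. average_probe_complexity N h (A w)"
  have fin: "finite (set_pmf ?p)" by (rule finite_workload)
  have st: "state n w" if "w \<in> set_pmf ?p" for w using state_workload_even that .
  have inner: "W * (i / 2 - exp W * E (?r w) (light_mass \<theta> w) - n * (?avg w + E (?r w) ?avg) / Y - (real N - 1 - n))
     \<le> E (?r w) (\<lambda>v. ?disp w v)" if w: "w \<in> set_pmf ?p" for w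
  proof -
    note finr = finite_run[OF st[OF w], of "2 * i"]
    have "W * (i / 2 - exp W * E (?r w) (light_mass \<theta> w) - n * (?avg w + E (?r w) ?avg) / Y - (real N - 1 - n)) \<le>
      W * (E (?r w) (\<lambda>v. card (keys w - keys v)) - exp W * E (?r w) (light_mass \<theta> w) - n * (?avg w + E (?r w) ?avg) / Y - (real N - 1 - n))"
      using run_deleted[OF st[OF w] i] W by (intro mult_left_mono) auto
    also have "\<dots> = E (?r w) (\<lambda>v. W * (real (card (keys w - keys v)) - exp W * light_mass \<theta> w v
      - n * (?avg w + ?avg v) / Y - (real N - 1 - n)))"
      using finr by (simp add: E_diff E_add)
    also have "\<dots> \<le> E (?r w) (\<lambda>v. ?disp w v)"
      using displacement_bound[OF st[OF w] state_run_even[OF st[OF w]] \<theta> W Y] by (intro E_mono finr)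
    finally show ?thesis .
  qed
  have lm: "E ?p (\<lambda>w. E (?r w) (light_mass \<theta> w)) \<le> real i ^ 2 / (n * (U - n)) * N * (2 * D)"
  proof -
    have "E ?p (\<lambda>w. E (?r w) (light_mass \<theta> w)) \<le> real i ^ 2 / (n * (U - n)) * card {1..<N} * (2 * D)"
      unfolding light_mass_def using \<theta> D small slot_of(2,3) by (intro E_light) auto
    also have "\<dots> \<le> real i ^ 2 / (n * (U - n)) * N * (2 * D)"
      using D by (intro mult_right_mono mult_left_mono) auto
    finally show ?thesis .
  qed
  have "E ?p ?avg \<le> P" "E ?p (\<lambda>w. E (?r w) ?avg) \<le> P"
    using P[of "2 * m"] P[of "2 * m + 2 * i"] E_workload_run[of m "2 * i" ?avg]
    by (auto simp: expected_average_probe_complexity_def)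
  then have "n * (E ?p ?avg + E ?p (\<lambda>w. E (?r w) ?avg)) / Y \<le> n * (P + P) / Y"
    using Y by (intro divide_right_mono mult_left_mono add_mono) auto
  then have "W * ?rhs \<le> W * (i / 2 - exp W * E ?p (\<lambda>w. E (?r w) (light_mass \<theta> w))
      - n * (E ?p ?avg + E ?p (\<lambda>w. E (?r w) ?avg)) / Y - (real N - 1 - n))"
    using lm W by (intro mult_left_mono diff_mono) (auto simp: algebra_simps)
  also have "\<dots> = E ?p (\<lambda>w. W * (i / 2 - exp W * E (?r w) (light_mass \<theta> w) - n * (?avg w + E (?r w) ?avg) / Y - (real N - 1 - n)))"
    using fin by (simp add: E_diff E_add)
  also have "\<dots> \<le> E ?p (\<lambda>w. E (?r w) (\<lambda>v. ?disp w v))"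
    using inner by (intro E_mono fin)
  finally show ?thesis .
qed

text \<open>The workload contains \<open>L div i\<close> disjoint epochs of \<open>2 * i\<close>
  operations, and by the triangle inequality the operations of an epoch accumulate at least its
  displacement. The remaining operations contribute nonnegative amounts.\<close>

lemma E_accumulated:
  assumes c: "0 \<le> c"
    and B: "\<And>m. m + i \<le> L \<Longrightarrow> B \<le> E (workload n U (2 * m)) (\<lambda>w. E (run U (2 * i) w) (\<lambda>v. displacement h U c Y (A w) (A v)))"
  shows "real (L div i) * B \<le> E (workload n U (2 * L)) (accumulated (\<lambda>p w. displacement h U c Y (A w) (A (p # w))) (2 * L))"
proof -
  let ?f = "accumulated (\<lambda>p w. displacement h U c Y (A w) (A (p # w)))"
  have nonneg: "0 \<le> ?f j w" for j w
    using displacement_nonneg[OF c] by (intro accumulated_nonneg)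
  have split: "E (workload n U (2 * m + i)) (?f (2 * m + i)) \<ge> E (workload n U (2 * m)) (?f (2 * m)) +
      E (workload n U (2 * m)) (\<lambda>w. E (run U i w) (\<lambda>v. displacement h U c Y (A w) (A v)))" for m i
  proof -
    have "E (workload n U (2 * m)) (?f (2 * m)) +
      E (workload n U (2 * m)) (\<lambda>w. E (run U i w) (\<lambda>v. displacement h U c Y (A w) (A v))) =
      E (workload n U (2 * m)) (\<lambda>w. ?f (2 * m) w + E (run U i w) (\<lambda>v. displacement h U c Y (A w) (A v)))"
      using finite_workload by (simp add: E_add)
    also have "\<dots> \<le> E (workload n U (2 * m)) (\<lambda>w. E (run U i w) (?f (2 * m + i)))"
    proof (intro E_mono finite_workload)
      fix w assume "w \<in> set_pmf (workload n U (2 * m))"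
      note st = state_workload_even[OF this]
      have "?f (2 * m) w + E (run U i w) (\<lambda>v. displacement h U c Y (A w) (A v)) =
         E (run U i w) (\<lambda>v. ?f (2 * m) w + displacement h U c Y (A w) (A v))"
        using finite_run[OF st] by (simp add: E_add)
      also have "\<dots> \<le> E (run U i w) (?f (2 * m + i))"
      proof (intro E_mono finite_run st)
        fix v assume "v \<in> set_pmf (run U i w)"
        then obtain us where "v = us @ w" "length us = i" using support_run[OF st] by blast
        then show "?f (2 * m) w + displacement h U c Y (A w) (A v) \<le> ?f (2 * m + i) v"
          using displacement_le_accumulated[OF c, of h U Y A w us]
            accumulated_append[of "\<lambda>p w. displacement h U c Y (A w) (A (p # w))" us "2 * m" w]
          by (simp add: add.commute)
      qed
      finally show "?f (2 * m) w + E (run U i w) (\<lambda>v. displacement h U c Y (A w) (A v)) \<le> E (run U i w) (?f (2 * m + i))" .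
    qed
    also have "\<dots> = E (workload n U (2 * m + i)) (?f (2 * m + i))"
      by (rule E_workload_run[symmetric])
    finally show ?thesis .
  qed
  have *: "e * i \<le> L \<Longrightarrow> real e * B \<le> E (workload n U (2 * (e * i))) (?f (2 * (e * i)))" for e
  proof (induction e)
    case (Suc e)
    have "real (Suc e) * B = real e * B + B" by (simp add: algebra_simps)
    also have "\<dots> \<le> E (workload n U (2 * (e * i))) (?f (2 * (e * i))) +
      E (workload n U (2 * (e * i))) (\<lambda>w. E (run U (2 * i) w) (\<lambda>v. displacement h U c Y (A w) (A v)))"
      using Suc B[of "e * i"] by (intro add_mono) auto
    also have "\<dots> \<le> E (workload n U (2 * (e * i) + 2 * i)) (?f (2 * (e * i) + 2 * i))"
      by (rule split)
    finally show ?case by (simp add: algebra_simps)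
  qed simp
  let ?e = "L div i"
  have "real ?e * B \<le> E (workload n U (2 * (?e * i))) (?f (2 * (?e * i)))"
    by (rule *) simp
  also have "\<dots> \<le> E (workload n U (2 * (?e * i))) (?f (2 * (?e * i))) +
      E (workload n U (2 * (?e * i))) (\<lambda>w. E (run U (2 * (L mod i)) w) (\<lambda>v. displacement h U c Y (A w) (A v)))"
    using displacement_nonneg[OF c] by (simp add: integral_nonneg)
  also have "\<dots> \<le> E (workload n U (2 * (?e * i) + 2 * (L mod i))) (?f (2 * (?e * i) + 2 * (L mod i)))"
    by (rule split)
  also have "2 * (?e * i) + 2 * (L mod i) = 2 * L"
    by (metis div_mult_mod_eq distrib_left)
  finally show ?thesis .
qed

end

section \<open>Summing over the scales\<close>

text \<open>The first nonzero term is at most 2, and every later term is half of its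
  predecessor.\<close>

lemma sum_truncated_geometric:
  assumes "0 \<le> (t::real)"
  shows "(\<Sum>l<k. if t \<le> 2 * 2 ^ l then t / 2 ^ l else 0) \<le> 4"
proof -
  \<comment> \<open>Once the terms have started, the whole tail after index k sums to t / 2^k, so
    the partial sum stays that far below 4.\<close>
  have "(\<Sum>l<Suc k. if t \<le> 2 * 2 ^ l then t / 2 ^ l else 0) \<le> (if t \<le> 2 * 2 ^ k then 4 - t / 2 ^ k else 0)" for k
  proof (induction k)
    case 0
    then show ?case by auto
  next
    case (Suc k)
    let ?S = "\<Sum>l<Suc k. if t \<le> 2 * 2 ^ l then t / 2 ^ l else 0"
    have half: "t / 2 ^ Suc k = t / 2 ^ k / 2" by simp
    show ?case
    proof (cases "t \<le> 2 * 2 ^ k")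
      case True
      moreover have "t \<le> 2 * 2 ^ Suc k" using True by (simp add: order_trans)
      ultimately show ?thesis using Suc.IH half by simp
    next
      case False
      then have S: "?S \<le> 0" using Suc.IH by simp
      show ?thesis
      proof (cases "t \<le> 2 * 2 ^ Suc k")
        case True
        then have "t / 2 ^ Suc k \<le> 2" by (simp add: field_simps)
        then show ?thesis using S True by simp
      next
        case False
        then show ?thesis using S by simp
      qed
    qed
  qed
  note * = this
  show ?thesis
  proof (cases k)
    case (Suc j)
    have "t / 2 ^ j \<ge> 0" using assms by simp
    then have "(if t \<le> 2 * 2 ^ j then 4 - t / 2 ^ j else 0) \<le> 4" by simp
    then show ?thesis using *[of j] unfolding Suc by linarith
  qed simp
qed

lemma sum_powers_half_le: "(\<Sum>l<k. 1 / (2::real) ^ l) \<le> 2"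
proof -
  have "(\<Sum>l<k. (1 / 2 :: real) ^ l) \<le> 2" by (simp add: sum_gp_strict)
  then show ?thesis by (simp add: power_one_over)
qed

text \<open>A label is charged only at scales whose squared size reaches it, that is once ln label /
  \<open>\<kappa>\<close> is at most \<open>2 * 2 ^ l\<close>; from there on its logarithm divided
  by \<open>W l\<close> is dominated by a geometric series. So one end of a move pays a bounded
  amount at all scales together, however large its label.\<close>

lemma sum_charges:
  assumes c: "0 \<le> c" and lam: "1 \<le> \<kappa>" and W: "\<And>l. l < k \<Longrightarrow> \<kappa> * 2 ^ l / 2 \<le> W l"
  shows "(\<Sum>l<k. charge h c (exp (2 * (\<kappa> * 2 ^ l))) y b / W l) \<le> 4 * c + 96"
proof (cases "\<exists>s. b = Some s \<and> probes h y s")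
  case False
  then have "charge h c Y y b = 0" for Y by (auto simp: charge_def split: option.split)
  then show ?thesis using c by simp
next
  case True
  then obtain s where b: "b = Some s" and p: "probes h y s" by blast
  let ?L = "ln (real (label h y s))"
  have l1: "1 \<le> real (label h y s)" using label(1)[OF p] by simp
  then have L0: "0 \<le> ?L" by simp
  have "(\<Sum>l<k. charge h c (exp (2 * (\<kappa> * 2 ^ l))) y b / W l) \<le>
     (\<Sum>l<k. 2 * c * (1 / 2 ^ l) + 24 * (if ?L / \<kappa> \<le> 2 * 2 ^ l then ?L / \<kappa> / 2 ^ l else 0))"
  proof (rule sum_mono)
    fix l assume l: "l \<in> {..<k}"
    have le: "real (label h y s) \<le> exp (2 * (\<kappa> * 2 ^ l)) \<longleftrightarrow> ?L / \<kappa> \<le> 2 * 2 ^ l"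
    proof -
      have "real (label h y s) \<le> exp (2 * (\<kappa> * 2 ^ l)) \<longleftrightarrow> ?L \<le> 2 * (\<kappa> * 2 ^ l)"
        using l1 by (metis exp_le_cancel_iff exp_ln less_le_trans zero_less_one)
      also have "\<dots> \<longleftrightarrow> ?L / \<kappa> \<le> 2 * 2 ^ l" using lam by (simp add: field_simps)
      finally show ?thesis .
    qed
    have pos: "0 < \<kappa> * 2 ^ l / 2" using lam by simp
    show "charge h c (exp (2 * (\<kappa> * 2 ^ l))) y b / W l \<le>
       2 * c * (1 / 2 ^ l) + 24 * (if ?L / \<kappa> \<le> 2 * 2 ^ l then ?L / \<kappa> / 2 ^ l else 0)"
    proof (cases "?L / \<kappa> \<le> 2 * 2 ^ l")
      case True
      have "charge h c (exp (2 * (\<kappa> * 2 ^ l))) y b / W l = (c + 12 * ?L) / W l"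
        using True le p b by (simp add: charge_def)
      also have "\<dots> \<le> (c + 12 * ?L) / (\<kappa> * 2 ^ l / 2)"
        using W[of l] l pos c L0 by (intro divide_left_mono) auto
      also have "\<dots> = 2 * c / 2 ^ l / \<kappa> + 24 * (?L / \<kappa> / 2 ^ l)"
        using lam by (simp add: field_simps)
      also have "2 * c / 2 ^ l / \<kappa> \<le> 2 * c * (1 / 2 ^ l)"
        using lam c by (simp add: divide_le_eq mult_le_cancel_left1)
      finally show ?thesis using True by simp
    next
      case False
      then show ?thesis using le p b c by (simp add: charge_def)
    qed
  qed
  also have "\<dots> = 2 * c * (\<Sum>l<k. 1 / 2 ^ l) + 24 * (\<Sum>l<k. if ?L / \<kappa> \<le> 2 * 2 ^ l then ?L / \<kappa> / 2 ^ l else 0)"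
    by (simp add: sum.distrib sum_distrib_left)
  also have "\<dots> \<le> 2 * c * 2 + 24 * 4"
    using c lam L0 sum_powers_half_le sum_truncated_geometric[of "?L / \<kappa>" k]
    by (intro add_mono mult_left_mono) auto
  finally show ?thesis by simp
qed

section \<open>Comparing displacement with switching cost\<close>

context random_table
begin

lemma legal_state: "legal U n w \<Longrightarrow> state (card (keys w)) w"
proof -
  assume l: "legal U n w"
  have "legal U n w \<Longrightarrow> finite (keys w) \<and> keys w \<subseteq> {1..U}" for w
    by (induction w rule: keys.induct) auto
  then show ?thesis using l by (simp add: state_def)
qed

lemma slot_not_special: "legal U n w \<Longrightarrow> A w y \<noteq> Some N"
  using table unfolding classical_table_def by (metis atLeastLessThan_iff less_irrefl)

lemma dom_table: "legal U n w \<Longrightarrow> dom (A w) = keys w"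
  using table unfolding classical_table_def by blast

text \<open>The only changed key that the switching cost can miss is the one operated on: a deleted
  key is not stored afterwards.\<close>

lemma changed_le_switching_cost:
  assumes l: "legal U n (p # w)"
  shows "card {y \<in> {1..U}. A w y \<noteq> A (p # w) y} \<le> switching_cost N A p w + 1"
proof -
  let ?S = "{y \<in> keys (p # w). before_rearranging N p (A w) y \<noteq> A (p # w) y}"
  have fin: "finite (keys (p # w))" using stateD(3)[OF legal_state[OF l]] .
  have lw: "legal U n w" using l by (cases p) auto
  obtain x where x: "p = Ins x \<or> p = Del x" by (cases p) auto
  have "{y \<in> {1..U}. A w y \<noteq> A (p # w) y} \<subseteq> insert x ?S"
  proof
    fix y assume y: "y \<in> {y \<in> {1..U}. A w y \<noteq> A (p # w) y}"
    show "y \<in> insert x ?S"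
    proof (cases "y = x")
      case False
      then have eq: "before_rearranging N p (A w) y = A w y" using x by auto
      have "y \<in> keys w \<or> y \<in> keys (p # w)"
        using y dom_table[OF lw] dom_table[OF l] by (auto simp: dom_def set_eq_iff)
      then have "y \<in> keys (p # w)" using False x by auto
      then show ?thesis using y eq by simp
    qed simp
  qed
  then have "card {y \<in> {1..U}. A w y \<noteq> A (p # w) y} \<le> card (insert x ?S)"
    using fin by (intro card_mono) auto
  also have "\<dots> \<le> card ?S + 1" using card_insert_le_m1[of "card ?S + 1" ?S x] by simp
  finally show ?thesis by (simp add: switching_cost_def)
qed

text \<open>The special slot must be empty after the operation, so the new key has to leave
  it.\<close>

lemma switching_cost_insert:
  assumes l: "legal U n (Ins x # w)"
  shows "1 \<le> switching_cost N A (Ins x) w"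
proof -
  let ?S = "{y \<in> keys (Ins x # w). before_rearranging N (Ins x) (A w) y \<noteq> A (Ins x # w) y}"
  have "x \<in> ?S" using slot_not_special[OF l, of x] by (metis (mono_tags, lifting) CollectI
    before_rearranging.simps(1) fun_upd_same insertI1 keys.simps(2))
  moreover have "finite ?S" using stateD(3)[OF legal_state[OF l]] by simp
  ultimately have "0 < card ?S" using card_gt_0_iff by blast
  then show ?thesis by (simp add: switching_cost_def)
qed

text \<open>Each insertion moves at least one key. This pays for the extra 1 in
  \<open>changed_le_switching_cost\<close> and is the whole argument when \<open>\<epsilon>\<close>
  is not small.\<close>

lemma total_switching_cost_ge:
  "w \<in> set_pmf (workload n U (2 * L)) \<Longrightarrow> L \<le> total_switching_cost N A (2 * L) w"
proof (induction L arbitrary: w)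
  case (Suc L)
  have l: "legal U n w" using stateD(1)[OF state_workload_even[OF Suc.prems]] .
  obtain v x y where w: "w = Ins x # Del y # v" and v: "v \<in> set_pmf (workload n U (2 * L))"
    using Suc.prems by (auto simp: random_insert_def random_delete_def)
  have "1 \<le> switching_cost N A (Ins x) (Del y # v)"
    using l unfolding w by (rule switching_cost_insert)
  then show ?case using Suc.IH[OF v] w by simp
qed simp

lemma E_total_switching_cost_ge:
  "L \<le> E (workload n U (2 * L)) (\<lambda>w. total_switching_cost N A (2 * L) w)"
proof -
  have "real L = E (workload n U (2 * L)) (\<lambda>w. real L)" by simp
  also have "\<dots> \<le> E (workload n U (2 * L)) (\<lambda>w. total_switching_cost N A (2 * L) w)"
    using total_switching_cost_ge by (intro E_mono finite_workload) simp
  finally show ?thesis .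
qed

text \<open>After exchanging the sums, each changed key pays at most \<open>B\<close> at each of its
  two ends for all scales together.\<close>

lemma displacements_le_switching_cost:
  assumes B: "\<And>y b. (\<Sum>l<k. charge h c (Y l) y b / W l) \<le> B" and B0: "0 \<le> B"
    and l: "legal U n (p # w)"
  shows "(\<Sum>l<k. displacement h U c (Y l) (A w) (A (p # w)) / W l) \<le> 2 * B * (switching_cost N A p w + 1)"
proof -
  let ?C = "{y \<in> {1..U}. A w y \<noteq> A (p # w) y}"
  have "(\<Sum>l<k. displacement h U c (Y l) (A w) (A (p # w)) / W l) =
    (\<Sum>l<k. \<Sum>y\<in>?C. charge h c (Y l) y (A w y) / W l + charge h c (Y l) y (A (p # w) y) / W l)"
  proof (intro sum.cong refl)
    fix l
    have "displacement h U c (Y l) (A w) (A (p # w)) =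
       (\<Sum>y\<in>?C. charge h c (Y l) y (A w y) + charge h c (Y l) y (A (p # w) y))"
      unfolding displacement_def by (intro sum.mono_neutral_cong_right) auto
    then show "displacement h U c (Y l) (A w) (A (p # w)) / W l =
      (\<Sum>y\<in>?C. charge h c (Y l) y (A w y) / W l + charge h c (Y l) y (A (p # w) y) / W l)"
      by (simp add: sum_divide_distrib add_divide_distrib)
  qed
  also have "\<dots> = (\<Sum>y\<in>?C. (\<Sum>l<k. charge h c (Y l) y (A w y) / W l) + (\<Sum>l<k. charge h c (Y l) y (A (p # w) y) / W l))"
    by (subst sum.swap) (simp add: sum.distrib)
  also have "\<dots> \<le> (\<Sum>y\<in>?C. B + B)"
    using B by (intro sum_mono add_mono)
  also have "\<dots> = 2 * B * card ?C" by simp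
  also have "\<dots> \<le> 2 * B * (switching_cost N A p w + 1)"
    using changed_le_switching_cost[OF l] B0 by (intro mult_left_mono) linarith+
  finally show ?thesis .
qed

lemma accumulated_le_total_switching_cost:
  assumes B: "\<And>y b. (\<Sum>l<k. charge h c (Y l) y b / W l) \<le> B" and B0: "0 \<le> B"
  shows "legal U n w \<Longrightarrow>
    (\<Sum>l<k. accumulated (\<lambda>p w. displacement h U c (Y l) (A w) (A (p # w))) j w / W l) \<le>
      2 * B * (total_switching_cost N A j w + j)"
proof (induction j arbitrary: w)
  case 0
  then show ?case using B0 by simp
next
  case (Suc j)
  show ?case
  proof (cases w)
    case Nil
    then show ?thesis using B0 by simp
  next
    case (Cons p v)
    have l: "legal U n (p # v)" using Suc.prems Cons by simp
    then have lv: "legal U n v" by (cases p) auto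
    have "(\<Sum>l<k. accumulated (\<lambda>p w. displacement h U c (Y l) (A w) (A (p # w))) (Suc j) w / W l) =
      (\<Sum>l<k. displacement h U c (Y l) (A v) (A (p # v)) / W l) +
      (\<Sum>l<k. accumulated (\<lambda>p w. displacement h U c (Y l) (A w) (A (p # w))) j v / W l)"
      by (simp add: Cons add_divide_distrib sum.distrib)
    also have "\<dots> \<le> 2 * B * (switching_cost N A p v + 1) + 2 * B * (total_switching_cost N A j v + j)"
      using displacements_le_switching_cost[OF B B0 l] Suc.IH[OF lv] by (intro add_mono)
    also have "\<dots> = 2 * B * (total_switching_cost N A (Suc j) w + Suc j)"
      by (simp add: Cons algebra_simps)
    finally show ?thesis .
  qed
qed

text \<open>An epoch replaces at least i / 2 keys in expectation, and each of three losses is at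
  most i / 16: light keys by the choice of \<open>W\<close>, high labels by
  \<open>64 * P \<le> I\<close>, free slots by \<open>I * (32 * b * \<epsilon>) \<le> 1\<close>. At
  least i / 4 remains, and the complete epochs cover at least half of \<open>L\<close>, whence the
  factor 1 / 8.\<close>

lemma scale_bound:
  fixes C I P b \<epsilon> :: real
  assumes nu: "nearly_uniform C n U N h" and C: "1 \<le> C" and b: "0 < b" and \<epsilon>: "0 < \<epsilon>" "\<epsilon> \<le> 1"
    and N: "real N \<le> (1 + b * \<epsilon>) * n" and L: "n \<le> L"
    and P: "\<And>j. j \<le> 2 * L \<Longrightarrow> expected_average_probe_complexity n U N h A j \<le> P"
    and I: "4 \<le> I" "I \<le> n" "64 * P \<le> I" "(128 * C * (1 + b))\<^sup>2 \<le> I" "I * (32 * b * \<epsilon>) \<le> 1"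
  obtains W where "ln I / 2 \<le> W"
    "W * L / 8 \<le> E (workload n U (2 * L))
       (accumulated (\<lambda>p w. displacement h U (ln (8 * C)) (I\<^sup>2) (A w) (A (p # w))) (2 * L))"
proof -
  define i where "i = nat \<lfloor>n / I\<rfloor>"
  \<comment> \<open>128 = 4 * 2 * 16: \<open>2 * D\<close> is \<open>4 * C * U / n\<close>,
    \<open>U / (U - n)\<close> is at most 2, and the light keys may take i / 16. That
    \<open>I\<close> is at least the square of the denominator keeps \<open>W\<close> above
    \<open>ln I / 2\<close>.\<close>
  define W where "W = ln (I / (128 * C * (1 + b)))"
  define D where "D = 2 * C * U / n"
  \<comment> \<open>Chosen so that the expected weight per link,
    \<open>n / U * (2 * \<theta> * D)\<close> = 4 C \<open>\<theta>\<close>, is 1 / 2.\<close>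
  define \<theta> where "\<theta> = 1 / (8 * C)"
  let ?K = "128 * C * (1 + b)"
  have n0: "0 < real n" and U0: "0 < real U" using n_pos U_large by auto
  have K0: "0 < ?K" using C b by simp
  have I0: "0 < I" using I by simp
  have ndI: "1 \<le> n / I" using I I0 by (simp add: field_simps)
  have i_le: "real i \<le> n / I" using ndI unfolding i_def by linarith
  have i_ge: "n / (2 * I) \<le> i"
  proof -
    have "n / I < real i + 1" using ndI unfolding i_def by linarith
    moreover have "1 \<le> real i" using ndI unfolding i_def by (simp add: le_nat_floor)
    ultimately have "n / I \<le> 2 * i" by linarith
    then show ?thesis by (simp add: field_simps)
  qed
  have i_pos: "0 < i" using ndI unfolding i_def by simp
  have i4: "4 * i \<le> n"
  proof -
    have "4 * (n / I) \<le> I * (n / I)" using I ndI by (intro mult_right_mono) auto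
    then have "4 * real i \<le> n" using i_le I0 by simp
    then show ?thesis by linarith
  qed
  have expW: "exp W = I / ?K" using K0 I0 by (simp add: W_def)
  have WI: "ln I / 2 \<le> W"
  proof -
    have "2 * ln ?K \<le> ln I"
      using I(4) K0 I0 ln_realpow[of ?K 2] by (metis ln_le_cancel_iff of_nat_numeral zero_less_power)
    moreover have "ln (I / z) = ln I - ln z" if "0 < z" for z using that I0 by (simp add: ln_div)
    ultimately show ?thesis unfolding W_def using K0 by simp
  qed
  have W0: "0 \<le> W" using WI I ln_ge_zero[of I] by linarith
  have \<theta>: "0 < \<theta>" "\<theta> \<le> 1" using C by (auto simp: \<theta>_def)
  have c: "- ln \<theta> = ln (8 * C)" "0 \<le> ln (8 * C)" using C by (auto simp: \<theta>_def ln_div)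
  have D0: "0 \<le> D" using C by (simp add: D_def)
  have Ds: "(\<Sum>y\<in>{1..U}. affinity h y s) \<le> D" if "s \<in> {1..<N}" for s
    unfolding D_def using sum_affinity_keys[OF nu, of s] that n_pos U_large C by simp
  have small: "n / U * (2 * \<theta> * D) \<le> 1 / 2"
    using n0 U0 C by (simp add: D_def \<theta>_def)
  have light: "exp W * (real i ^ 2 / (n * (U - n)) * N * (2 * D)) \<le> i / 16"
  proof -
    have Un: "real U \<le> 2 * real (U - n)" "0 < real (U - n)" using U_large n_pos by auto
    have "real N \<le> (1 + b) * n"
    proof (rule order_trans[OF N])
      show "(1 + b * \<epsilon>) * real n \<le> (1 + b) * real n"
        using b \<epsilon> by (intro mult_right_mono) (auto simp: mult_left_le)
    qed
    then have "exp W * (real i ^ 2 / (n * (U - n)) * N * (2 * D)) \<le>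
       exp W * (real i ^ 2 / (n * (U - n)) * ((1 + b) * n) * (2 * D))"
      using D0 by (intro mult_left_mono mult_right_mono) auto
    also have "\<dots> = i * (i / n) * (I / 32) * (U / (U - n))"
    proof -
      have "I / (128 * C * z) * (j ^ 2 / (m * u) * (z * m) * (2 * (2 * C * v / m))) = j * (j / m) * (I / 32) * (v / u)"
        if "0 < m" "0 < u" "0 < z" for z j m u v :: real
      proof -
        have "C \<noteq> 0" "z \<noteq> 0" "m \<noteq> 0" "u \<noteq> 0" using that C by auto
        then show ?thesis by (simp add: divide_simps power2_eq_square)
      qed
      from this[OF n0 Un(2), of "1 + b" i U] show ?thesis
        unfolding expW D_def using b by simp
    qed
    also have "\<dots> \<le> i * (1 / I) * (I / 32) * 2"
    proof (intro mult_mono)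
      show "i / n \<le> 1 / I" using i_le n0 I0 by (simp add: field_simps)
      show "U / (U - n) \<le> (2::real)" using Un by (simp add: field_simps)
    qed (use I0 in auto)
    also have "\<dots> = i / 16" using I0 by simp
    finally show ?thesis .
  qed
  have big: "2 * n * P / I\<^sup>2 \<le> i / 16"
  proof -
    have "2 * n * P / I\<^sup>2 \<le> 2 * n * (I / 64) / I\<^sup>2"
      using I by (intro divide_right_mono mult_left_mono) auto
    also have "\<dots> = n / (2 * I) / 16" using I0 by (simp add: power2_eq_square)
    finally show ?thesis using i_ge by simp
  qed
  have holes: "real N - 1 - n \<le> i / 16"
  proof -
    have "real N - 1 - n \<le> b * \<epsilon> * n" using N by (simp add: algebra_simps)
    also have "\<dots> \<le> n / (2 * I) / 16"
      using I(5) I0 n0 by (simp add: field_simps)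
    finally show ?thesis using i_ge by simp
  qed
  have B: "W * i / 4 \<le> E (workload n U (2 * m)) (\<lambda>w. E (run U (2 * i) w) (\<lambda>v. displacement h U (- ln \<theta>) (I\<^sup>2) (A w) (A v)))"
    if m: "m + i \<le> L" for m
  proof -
    have "W * (i / 4) \<le> W * (i / 2 - exp W * (real i ^ 2 / (n * (U - n)) * N * (2 * D)) - 2 * n * P / I\<^sup>2 - (real N - 1 - n))"
      using light big holes W0 by (intro mult_left_mono) auto
    also have "\<dots> \<le> E (workload n U (2 * m)) (\<lambda>w. E (run U (2 * i) w) (\<lambda>v. displacement h U (- ln \<theta>) (I\<^sup>2) (A w) (A v)))"
      using m I0 by (intro E_displacement \<theta> W0 D0 Ds small i4 P) auto
    finally show ?thesis by simp
  qed
  have "L / 2 \<le> real (L div i) * i"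
  proof -
    have "i \<le> L" using i4 L by simp
    then have "L mod i < i" "i \<le> L div i * i" using i_pos by (auto simp: Suc_leI div_greater_zero_iff)
    then have "L \<le> 2 * (L div i * i)" using div_mult_mod_eq[of L i] by linarith
    then have "real L \<le> real (2 * (L div i * i))" by (rule of_nat_mono)
    then show ?thesis by simp
  qed
  then have "W / 4 * (L / 2) \<le> W / 4 * (real (L div i) * i)"
    using W0 by (intro mult_left_mono) auto
  also have "\<dots> = real (L div i) * (W * i / 4)" by simp
  also have "\<dots> \<le> E (workload n U (2 * L)) (accumulated (\<lambda>p w. displacement h U (- ln \<theta>) (I\<^sup>2) (A w) (A (p # w))) (2 * L))"
    using c B by (intro E_accumulated) auto
  finally show ?thesis using that[of W] WI unfolding c by simp
qed

text \<open>Divided by \<open>W l\<close>, every scale demands the same displacement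
  \<open>n ^ 2 / 8\<close>, while by \<open>sum_charges\<close> one move serves all scales only up
  to a constant. So the number of moves grows with the number \<open>k\<close> of scales.\<close>

theorem switching_cost_bound:
  fixes C \<kappa> P b \<epsilon> :: real and k :: nat
  assumes nu: "nearly_uniform C n U N h" and C: "1 \<le> C" and b: "0 < b" and \<epsilon>: "0 < \<epsilon>" "\<epsilon> \<le> 1"
    and N: "real N \<le> (1 + b * \<epsilon>) * n"
    and P: "\<And>j. j \<le> 2 * n ^ 2 \<Longrightarrow> expected_average_probe_complexity n U N h A j \<le> P"
    and lam: "1 \<le> \<kappa>" "4 \<le> exp \<kappa>" "64 * P \<le> exp \<kappa>" "(128 * C * (1 + b))\<^sup>2 \<le> exp \<kappa>"
    and top: "\<And>l. l < k \<Longrightarrow> exp (\<kappa> * 2 ^ l) \<le> n \<and> exp (\<kappa> * 2 ^ l) * (32 * b * \<epsilon>) \<le> 1"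
  shows "k / (96 * (4 * ln (8 * C) + 96)) \<le> expected_amortized_switching_cost n U N A"
proof -
  let ?L = "n ^ 2" and ?c = "ln (8 * C)" and ?Y = "\<lambda>l. exp (2 * (\<kappa> * 2 ^ l))"
  let ?p = "workload n U (2 * ?L)"
  let ?acc = "\<lambda>l. accumulated (\<lambda>p w. displacement h U ?c (?Y l) (A w) (A (p # w))) (2 * ?L)"
  let ?T = "E ?p (\<lambda>w. total_switching_cost N A (2 * ?L) w)"
  let ?B = "4 * ?c + 96"
  have c0: "0 \<le> ?c" using C by simp
  have "\<forall>l. \<exists>W :: real. l < k \<longrightarrow> \<kappa> * 2 ^ l / 2 \<le> W \<and> W * ?L / 8 \<le> E ?p (?acc l)"
  proof (intro allI, unfold ex_simps, intro impI)
    fix l assume l: "l < k"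
    let ?I = "exp (\<kappa> * 2 ^ l)"
    have "\<kappa> * 1 \<le> \<kappa> * 2 ^ l" using lam by (intro mult_left_mono) auto
    then have I: "exp \<kappa> \<le> ?I" by simp
    have nL: "n \<le> n ^ 2" using n_pos by (simp add: power2_eq_square)
    have eq: "?I\<^sup>2 = ?Y l" by (rule exp_double[symmetric])
    obtain W where "ln ?I / 2 \<le> W" "W * ?L / 8 \<le> E ?p (accumulated (\<lambda>p w. displacement h U ?c (?I\<^sup>2) (A w) (A (p # w))) (2 * ?L))"
      by (rule scale_bound[OF nu C b \<epsilon> N nL P order_trans[OF lam(2) I] _
          order_trans[OF lam(3) I] order_trans[OF lam(4) I]]) (use top[OF l] in auto)
    then show "\<exists>W. \<kappa> * 2 ^ l / 2 \<le> W \<and> W * ?L / 8 \<le> E ?p (?acc l)"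
      unfolding eq ln_exp by blast
  qed
  from choice[OF this] obtain W where W: "\<And>l. l < k \<Longrightarrow> \<kappa> * 2 ^ l / 2 \<le> W l"
    and acc: "\<And>l. l < k \<Longrightarrow> W l * ?L / 8 \<le> E ?p (?acc l)"
    by blast
  have W0: "0 < W l" if "l < k" for l
  proof -
    have "0 < \<kappa> * 2 ^ l / 2" using lam by simp
    then show ?thesis using W[OF that] by linarith
  qed
  have ch: "(\<Sum>l<k. charge h ?c (?Y l) y b / W l) \<le> ?B" for y b
    using sum_charges[OF c0 lam(1) W] .
  have "k * (?L / 8) = (\<Sum>l<k. ?L / 8)" by simp
  also have "\<dots> \<le> (\<Sum>l<k. E ?p (?acc l) / W l)"
  proof (rule sum_mono)
    fix l assume "l \<in> {..<k}"
    then show "?L / 8 \<le> E ?p (?acc l) / W l"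
      using acc[of l] W0[of l] by (simp add: field_simps)
  qed
  also have "\<dots> = E ?p (\<lambda>w. \<Sum>l<k. ?acc l w / W l)"
    by (simp only: E_sum finite_workload integral_divide_zero)
  also have "\<dots> \<le> E ?p (\<lambda>w. 2 * ?B * (real (total_switching_cost N A (2 * ?L) w) + 2 * ?L))"
  proof (intro E_mono finite_workload)
    fix w assume "w \<in> set_pmf ?p"
    then have "legal U n w" using stateD(1)[OF state_workload_even] by blast
    from accumulated_le_total_switching_cost[OF ch _ this, of "2 * ?L"]
    show "(\<Sum>l<k. ?acc l w / W l) \<le> 2 * ?B * (real (total_switching_cost N A (2 * ?L) w) + 2 * ?L)"
      using c0 by simp
  qed
  also have "\<dots> = 2 * ?B * (?T + 2 * ?L)"
    using finite_workload by (simp add: E_add)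
  \<comment> \<open>At least one move per insertion gives \<open>?L \<le> ?T\<close>, which absorbs
    the additional 1 per operation.\<close>
  also have "\<dots> \<le> 2 * ?B * (3 * ?T)"
    using E_total_switching_cost_ge[of ?L] c0 by (intro mult_left_mono) auto
  also have "\<dots> = 6 * ?B * ?T"
  proof -
    have "2 * B * (3 * T) = 6 * B * T" for B T :: real by simp
    then show ?thesis .
  qed
  finally have main: "k * (?L / 8) \<le> 6 * ?B * ?T" .
  have "k / (96 * B) \<le> T / (2 * L)" if "k * (L / 8) \<le> 6 * B * T" "0 < L" "0 < B" for k L B T :: real
    using that by (simp add: field_simps)
  from this[OF main] have "k / (96 * ?B) \<le> ?T / (2 * real ?L)"
    using n_pos c0 by simp
  then show ?thesis by (simp add: expected_amortized_switching_cost_def)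
qed

end

section \<open>Fitting the scales to a given load factor\<close>

lemma nearly_uniform_mono:
  "nearly_uniform C n U N h \<Longrightarrow> C \<le> C' \<Longrightarrow> nearly_uniform C' n U N h"
  unfolding nearly_uniform_def by (meson mult_right_mono order_trans zero_le_even_power of_nat_0_le_iff zero_le_power)

lemma le_two_powr:
  assumes "1 \<le> (s::real)"
  shows "s \<le> 2 powr s"
proof -
  have "Suc (nat \<lfloor>s\<rfloor>) \<le> 2 ^ nat \<lfloor>s\<rfloor>" by (rule Suc_leI) (rule less_exp)
  then have "real (Suc (nat \<lfloor>s\<rfloor>)) \<le> 2 ^ nat \<lfloor>s\<rfloor>" by (metis of_nat_le_iff of_nat_numeral of_nat_power)
  moreover have "s \<le> real (Suc (nat \<lfloor>s\<rfloor>))" using assms by linarith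
  ultimately have "s \<le> 2 ^ nat \<lfloor>s\<rfloor>" by linarith
  also have "(2::real) ^ nat \<lfloor>s\<rfloor> = 2 powr real (nat \<lfloor>s\<rfloor>)" by (simp add: powr_realpow)
  also have "\<dots> \<le> 2 powr s" using assms by (intro powr_mono) auto
  finally show ?thesis .
qed

lemma (in random_table) amortized_ge_half: "1 / 2 \<le> expected_amortized_switching_cost n U N A"
proof -
  have "1 / 2 \<le> T / real (2 * L)" if "real L \<le> T" "0 < L" for T and L :: nat
    using that by (simp add: field_simps)
  from this[OF E_total_switching_cost_ge[of "n ^ 2"]] show ?thesis
    using n_pos by (simp add: expected_amortized_switching_cost_def)
qed

text \<open>The lowest scale is \<open>exp \<kappa>\<close> = (2 powr s)^2: one factor 2 powr s
  covers the probe bound, the other its constant, because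
  \<open>64 * K \<le> s \<le> 2 powr s\<close>. The highest scale is at most
  \<open>\<epsilon>\<close> to the power -1 / 2, and the other half of 1 / \<open>\<epsilon>\<close>
  absorbs \<open>32 * b\<close>.\<close>

lemma (in random_table) switching_cost_loglog:
  fixes C K b \<epsilon> s :: real
  assumes nu: "nearly_uniform C n U N h" and C: "1 \<le> C" and b: "0 < b" and K: "1 \<le> K"
    and \<epsilon>: "0 < \<epsilon>" "\<epsilon> \<le> 1" "1 / n \<le> \<epsilon>" and N: "real N \<le> (1 + b * \<epsilon>) * n"
    and P: "\<And>j. j \<le> 2 * n ^ 2 \<Longrightarrow> expected_average_probe_complexity n U N h A j \<le> K * 2 powr s"
    and s: "2 powr (s\<^sup>2) = 1 / \<epsilon>" "16 \<le> s" "64 * K \<le> s" "128 * C * (1 + b) \<le> s" "32 * b \<le> s"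
  shows "log 2 s / 2 / (96 * (4 * ln (8 * C) + 96)) \<le> expected_amortized_switching_cost n U N A"
proof -
  \<comment> \<open>The largest admissible l has \<open>2 ^ l \<le> s / 4\<close>, which means
    \<open>2 * s * 2 ^ l \<le> s\<^sup>2 / 2\<close> in the exponent of 2.\<close>
  define k where "k = Suc (nat \<lfloor>log 2 (s / 4)\<rfloor>)"
  let ?\<kappa> = "2 * s * ln 2"
  have sp: "s \<le> 2 powr s" using s by (intro le_two_powr) simp
  have e: "exp (?\<kappa> * x) = 2 powr (2 * s * x)" for x by (simp add: powr_def mult_ac)
  have e1: "exp ?\<kappa> = 2 powr s * 2 powr s" by (simp add: powr_def mult_ac flip: exp_add)
  have ln2: "1 / 2 \<le> ln (2::real)"
    using exp_half_le2 by (subst ln_ge_iff) auto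
  have lam1: "1 \<le> ?\<kappa>"
    using s ln2 mult_mono[of 16 s "1 / 2" "ln 2"] by simp
  have lam2: "4 \<le> exp ?\<kappa>"
    unfolding e1 using sp s mult_mono[of 4 "2 powr s" 1 "2 powr s"] by simp
  have lam3: "64 * (K * 2 powr s) \<le> exp ?\<kappa>"
    unfolding e1 using s sp mult_right_mono[of "64 * K" "2 powr s" "2 powr s"] by simp
  have lam4: "(128 * C * (1 + b))\<^sup>2 \<le> exp ?\<kappa>"
    unfolding e1 power2_eq_square using s sp C b by (intro mult_mono) auto
  have log4: "log 2 (s / 4) = log 2 s - 2"
    using s by (simp add: log_divide) (simp add: log_def ln_realpow[of 2 2, simplified])
  have logs: "4 \<le> log 2 s"
    using s by (simp add: le_log_iff powr_numeral)
  have top: "exp (?\<kappa> * 2 ^ l) \<le> n \<and> exp (?\<kappa> * 2 ^ l) * (32 * b * \<epsilon>) \<le> 1" if l: "l < k" for l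
  proof -
    have "real l \<le> log 2 (s / 4)" using l logs log4 unfolding k_def by linarith
    then have "2 powr real l \<le> s / 4" using s by (simp add: le_log_iff)
    then have "2 ^ l \<le> s / 4" by (simp add: powr_realpow)
    then have "2 * s * 2 ^ l \<le> 2 * s * (s / 4)" using s by (intro mult_left_mono) auto
    then have le: "exp (?\<kappa> * 2 ^ l) \<le> 2 powr (s\<^sup>2 / 2)"
      unfolding e by (intro powr_mono) (auto simp: power2_eq_square)
    have sq: "2 powr (s\<^sup>2 / 2) * 2 powr (s\<^sup>2 / 2) = 1 / \<epsilon>"
      using s(1) by (simp flip: powr_add)
    have "s \<le> s\<^sup>2 / 2" using s by (simp add: power2_eq_square)
    then have big: "s \<le> 2 powr (s\<^sup>2 / 2)" using sp powr_mono[of s "s\<^sup>2 / 2" 2] by linarith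
    have "2 powr (s\<^sup>2 / 2) * 1 \<le> 2 powr (s\<^sup>2 / 2) * 2 powr (s\<^sup>2 / 2)"
      using big s by (intro mult_left_mono) auto
    also have "\<dots> \<le> n" unfolding sq using \<epsilon> n_pos by (simp add: field_simps)
    finally have 1: "exp (?\<kappa> * 2 ^ l) \<le> n" using le by simp
    have "exp (?\<kappa> * 2 ^ l) * (32 * b * \<epsilon>) \<le> 2 powr (s\<^sup>2 / 2) * (2 powr (s\<^sup>2 / 2) * \<epsilon>)"
      using le big s b \<epsilon> by (intro mult_mono mult_right_mono) auto
    also have "\<dots> = 1" using sq \<epsilon> by (simp add: mult.assoc[symmetric])
    finally show ?thesis using 1 by blast
  qed
  have "log 2 s / 2 / (96 * (4 * ln (8 * C) + 96)) \<le> k / (96 * (4 * ln (8 * C) + 96))"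
  proof (rule divide_right_mono)
    \<comment> \<open>\<open>k\<close> is at least log 2 s - 2, and \<open>16 \<le> s\<close> makes
      this at least half of log 2 s.\<close>
    show "log 2 s / 2 \<le> k" using log4 logs unfolding k_def by linarith
    have "0 \<le> ln (8 * C)" using C by simp
    then show "0 \<le> 96 * (4 * ln (8 * C) + 96)"
      by (intro mult_nonneg_nonneg add_nonneg_nonneg) auto
  qed
  also have "\<dots> \<le> expected_amortized_switching_cost n U N A"
    by (rule switching_cost_bound[OF nu C b \<epsilon>(1,2) N P lam1 lam2 lam3 lam4 top])
  finally show ?thesis .
qed

text \<open>If sqrt (log 2 (1 / \<open>\<epsilon>\<close>)) exceeds a threshold depending on the
  constants, \<open>switching_cost_loglog\<close> applies. Below it the iterated logarithm is
  bounded above, and the one move forced by each insertion suffices for a small \<open>c\<close>.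
  Universe size n^2 is enough to have \<open>2 * n \<le> U\<close>.\<close>

theorem theorem4:
  shows "\<exists>d\<^sub>0 :: nat. \<forall>(d :: nat) (C :: real) (K :: real) (a :: real) (b :: real) (\<epsilon>\<^sub>0 :: real).
    a > 0 \<longrightarrow> b > 0 \<longrightarrow> \<epsilon>\<^sub>0 < 1 \<longrightarrow>
    (\<exists>c > 0. \<forall>(n :: nat) (U :: nat) (N :: nat) (\<epsilon> :: real) (h :: probe_fun) (A :: hash_table).
       n \<ge> 1 \<longrightarrow>
       n ^ d\<^sub>0 \<le> U \<longrightarrow> U \<le> n ^ d \<longrightarrow>
       1 / real n \<le> \<epsilon> \<longrightarrow> \<epsilon> \<le> \<epsilon>\<^sub>0 \<longrightarrow>
       (1 + a * \<epsilon>) * real n \<le> real N \<longrightarrow> real N \<le> (1 + b * \<epsilon>) * real n \<longrightarrow>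
       probe_function U N h \<longrightarrow>
       nearly_uniform C n U N h \<longrightarrow>
       classical_table U n N h A \<longrightarrow>
       (\<forall>j \<le> 2 * n ^ 2.
          expected_average_probe_complexity n U N h A j \<le> K * 2 powr sqrt (log 2 (1 / \<epsilon>))) \<longrightarrow>
       expected_amortized_switching_cost n U N A \<ge> c * log 2 (log 2 (1 / \<epsilon>)))"
proof (rule exI[of _ 2], intro allI impI)
  fix d :: nat and C K a b \<epsilon>\<^sub>0 :: real
  assume b: "b > 0" and \<epsilon>\<^sub>0: "\<epsilon>\<^sub>0 < 1"
  define C' where "C' = max C 1"
  define K' where "K' = max K 1"
  \<comment> \<open>384 = 4 * 96: a factor 2 from log 2 (log 2 (1 / \<open>\<epsilon>\<close>)) = 2
    log 2 s, and another because the number of scales is only bounded below by log 2 s / 2.\<close>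
  define B where "B = 384 * (4 * ln (8 * C') + 96)"
  define s\<^sub>0 where "s\<^sub>0 = Max {16, 64 * K', 128 * C' * (1 + b), 32 * b}"
  have s0: "16 \<le> s\<^sub>0" "64 * K' \<le> s\<^sub>0" "128 * C' * (1 + b) \<le> s\<^sub>0" "32 * b \<le> s\<^sub>0"
    by (auto simp: s\<^sub>0_def)
  have log0: "0 < log 2 s\<^sub>0" using s0 by simp
  have "1 \<le> 8 * C'" by (simp add: C'_def)
  then have "0 \<le> ln (8 * C')" by (rule ln_ge_zero)
  then have B0: "0 < B" by (simp add: B_def)
  define c where "c = min (1 / B) (1 / (4 * log 2 s\<^sub>0))"
  have c: "0 < c" "c \<le> 1 / B" "c \<le> 1 / (4 * log 2 s\<^sub>0)"
    using log0 B0 by (auto simp: c_def)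
  show "\<exists>c > 0. \<forall>(n :: nat) (U :: nat) (N :: nat) (\<epsilon> :: real) (h :: probe_fun) (A :: hash_table).
       n \<ge> 1 \<longrightarrow>
       n ^ 2 \<le> U \<longrightarrow> U \<le> n ^ d \<longrightarrow>
       1 / real n \<le> \<epsilon> \<longrightarrow> \<epsilon> \<le> \<epsilon>\<^sub>0 \<longrightarrow>
       (1 + a * \<epsilon>) * real n \<le> real N \<longrightarrow> real N \<le> (1 + b * \<epsilon>) * real n \<longrightarrow>
       probe_function U N h \<longrightarrow>
       nearly_uniform C n U N h \<longrightarrow>
       classical_table U n N h A \<longrightarrow>
       (\<forall>j \<le> 2 * n ^ 2.
          expected_average_probe_complexity n U N h A j \<le> K * 2 powr sqrt (log 2 (1 / \<epsilon>))) \<longrightarrow>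
       expected_amortized_switching_cost n U N A \<ge> c * log 2 (log 2 (1 / \<epsilon>))"
  proof (intro exI[of _ c] conjI allI impI c(1))
    fix n U N :: nat and \<epsilon> :: real and h :: probe_fun and A :: hash_table
    assume n: "n \<ge> 1" and U: "n ^ 2 \<le> U" and \<epsilon>: "1 / real n \<le> \<epsilon>" "\<epsilon> \<le> \<epsilon>\<^sub>0"
      and N: "real N \<le> (1 + b * \<epsilon>) * real n"
      and nu: "nearly_uniform C n U N h" and table: "classical_table U n N h A"
      and probe: "\<forall>j \<le> 2 * n ^ 2. expected_average_probe_complexity n U N h A j \<le> K * 2 powr sqrt (log 2 (1 / \<epsilon>))"
    have \<epsilon>01: "0 < \<epsilon>" "\<epsilon> < 1" using n \<epsilon> \<epsilon>\<^sub>0 less_le_trans[of 0 "1 / real n" \<epsilon>] by auto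
    \<comment> \<open>The case n = 1 would force \<open>\<epsilon>\<close> to be at least 1, so n is
      at least 2 and \<open>n ^ 2\<close> exceeds or equals \<open>2 * n\<close>.\<close>
    have "1 / real n < 1" using \<epsilon> \<epsilon>01 by linarith
    then have n2: "2 \<le> n" using n by (cases "n = 1") auto
    then have "2 * n \<le> n ^ 2" by (simp add: power2_eq_square)
    then interpret random_table n U N h A
      using n U table by unfold_locales auto
    define s where "s = sqrt (log 2 (1 / \<epsilon>))"
    have E: "0 < log 2 (1 / \<epsilon>)" using \<epsilon>01 by simp
    have s: "0 < s" "s\<^sup>2 = log 2 (1 / \<epsilon>)" using E by (auto simp: s_def)
    have loglog: "log 2 (log 2 (1 / \<epsilon>)) = 2 * log 2 s"
      using s by (simp flip: s(2) add: log_nat_power)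
    show "c * log 2 (log 2 (1 / \<epsilon>)) \<le> expected_amortized_switching_cost n U N A"
    proof (cases "s\<^sub>0 \<le> s")
      case True
      have "log 2 s / 2 / (96 * (4 * ln (8 * C') + 96)) \<le> expected_amortized_switching_cost n U N A"
      proof (rule switching_cost_loglog[where b = b and \<epsilon> = \<epsilon> and K = K'])
        show "nearly_uniform C' n U N h" using nu by (rule nearly_uniform_mono) (simp add: C'_def)
        show "expected_average_probe_complexity n U N h A j \<le> K' * 2 powr s" if "j \<le> 2 * n ^ 2" for j
        proof -
          have "K * 2 powr s \<le> K' * 2 powr s" by (intro mult_right_mono) (auto simp: K'_def)
          then show ?thesis using probe that unfolding s_def by (meson order_trans)
        qed
        show "2 powr s\<^sup>2 = 1 / \<epsilon>" using s \<epsilon>01 by simp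
      qed (use True s0 \<epsilon> \<epsilon>01 b N in \<open>auto simp: C'_def K'_def\<close>)
      moreover have "c * (2 * log 2 s) \<le> 1 / B * (2 * log 2 s)"
        using c True s0 by (intro mult_right_mono) auto
      moreover have "1 / B * (2 * log 2 s) = log 2 s / 2 / (96 * (4 * ln (8 * C') + 96))"
      proof -
        have "1 / (384 * z) * (2 * x) = x / 2 / (96 * z)" for x z :: real by (simp add: field_simps)
        then show ?thesis unfolding B_def .
      qed
      ultimately show ?thesis unfolding loglog by linarith
    next
      case False
      then have "log 2 s \<le> log 2 s\<^sub>0" using s by simp
      then have "c * (2 * log 2 s) \<le> c * (2 * log 2 s\<^sub>0)"
        using c by (intro mult_left_mono) auto
      also have "\<dots> \<le> 1 / (4 * log 2 s\<^sub>0) * (2 * log 2 s\<^sub>0)"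
        using c log0 by (intro mult_right_mono) auto
      also have "\<dots> = 1 / 2" using log0 by simp
      finally show ?thesis unfolding loglog using amortized_ge_half by linarith
    qed
  qed
qed

end
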